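(* Let $\nu,\lambda\in[0,1]$. Let $\rho^{\nu}$ be a resource state with security parameter $\nu$, and let $\rho^{\nu,\lambda}=(1-\lambda)\rho^{\nu}+\lambda|0\rangle\langle 0|$ be the corresponding resource state with $\lambda$ loss, where $|0\rangle$ is the vacuum. Then the one-bit communication protocol run with resource state $\rho^{\nu,\lambda}$ is $(1-(1-\lambda)\nu)$-secure. That is, there exists a density operator $\tau$ such that for every input bit $x\in\{0,1\}$ of Alice, $$\Delta\left(\tau,\sigma_x^{\nu,\lambda}\right)\le(1-\lambda)\nu ,$$ where $\sigma_x^{\nu,\lambda}$ is the density operator to which the eavesdropper has access when Alice's input is $x$.
   Context: Setting. Let $\mathcal F$ be the bosonic Fock space of two modes, Alice's and Bob's, with creation operators $\hat a^\dagger$ and $\hat b^\dagger$, vacuum $|0\rangle$, and number operators $\hat N_a=\hat a^\dagger\hat a$ and $\hat N_b=\hat b^\dagger\hat b$. A resource state is a density operator on $\mathcal F$. The trace distance is $\Delta(\rho,\sigma)=\tfrac12\|\rho-\sigma\|_1$. Security parameter and loss. A resource state $\rho^\nu$ has security parameter $\nu$ if $$\min_{n,\,|\psi\rangle}\Delta\left(|\psi\rangle\langle\psi|,\rho^\nu\right)\le\nu,$$ where the minimum is over integers $n\ge 0$ and unit vectors $|\psi\rangle\in\operatorname{span}\{(\hat a^\dagger)^k(\hat b^\dagger)^{n-k}|0\rangle : 0\le k\le n\}$; that is, some pure state with fixed total photon number $n$ is within trace distance $\nu$ of $\rho^\nu$. A resource state with $\lambda$ loss is $\rho^{\nu,\lambda}=(1-\lambda)\rho^\nu+\lambda|0\rangle\langle0|$.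 Protocol (transmission of one bit $x\in\{0,1\}$ from Alice to Bob). Alice and Bob share a resource state $\rho$. Bob picks $y\in\{0,1\}$ uniformly at random, independently of everything else, and keeps it secret. Alice encodes $x$ by the phase operation $\hat a^\dagger\mapsto(-1)^x\hat a^\dagger$, and Bob encodes $y$ by the phase operation $\hat b^\dagger\mapsto(-1)^y\hat b^\dagger$; i.e. the unitary $U_{x,y}=(-1)^{x\hat N_a}(-1)^{y\hat N_b}$ is applied to $\rho$. Both then send their parts of the state through the channel. The eavesdropper has access to the two modes after encoding, but not to $x$ or $y$, so for input $x$ the eavesdropper's density operator is $$\sigma_x=\tfrac12\sum_{y\in\{0,1\}}U_{x,y}\,\rho\,U_{x,y}^\dagger .$$ For $\rho=\rho^{\nu,\lambda}$ this is written $\sigma_x^{\nu,\lambda}$. Approximate security. The protocol is called $(1-\delta)$-secure if there exists a density operator $\tau$ (not depending on $x$) such that $\Delta(\tau,\sigma_x)\le\delta$ for every input $x$ from Alice. *)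

theory Defs
  imports "HOL-Analysis.Analysis"
begin

section \<open>The complex Hilbert space of square-summable families\<close>

definition square_summable :: "('a \<Rightarrow> complex) \<Rightarrow> bool" where
  "square_summable f \<longleftrightarrow> (\<lambda>i. (cmod (f i))\<^sup>2) summable_on UNIV"

lemma square_summable_zero: "square_summable (\<lambda>_. 0)"
  by (simp add: square_summable_def)

lemma square_summable_add:
  assumes "square_summable f" "square_summable g"
  shows "square_summable (\<lambda>i. f i + g i)"
  unfolding square_summable_def
proof (rule summable_on_comparison_test)
  show "(\<lambda>i. 2 * (cmod (f i))\<^sup>2 + 2 * (cmod (g i))\<^sup>2) summable_on UNIV"
    using assms unfolding square_summable_def
    by (intro summable_on_add summable_on_cmult_right)
  fix i
  have "(cmod (f i + g i))\<^sup>2 \<le> (cmod (f i) + cmod (g i))\<^sup>2"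
    by (intro power_mono norm_triangle_ineq norm_ge_zero)
  also have "\<dots> \<le> 2 * (cmod (f i))\<^sup>2 + 2 * (cmod (g i))\<^sup>2"
    using sum_squares_bound[of "cmod (f i)" "cmod (g i)"] by (simp add: power2_sum)
  finally show "(cmod (f i + g i))\<^sup>2 \<le> 2 * (cmod (f i))\<^sup>2 + 2 * (cmod (g i))\<^sup>2" .
qed auto

lemma square_summable_mult:
  "square_summable f \<Longrightarrow> square_summable (\<lambda>i. c * f i)"
  unfolding square_summable_def by (simp add: norm_mult power_mult_distrib summable_on_cmult_right)

lemma square_summable_uminus: "square_summable f \<Longrightarrow> square_summable (\<lambda>i. - f i)"
  by (simp add: square_summable_def)

lemma square_summable_single: "square_summable (\<lambda>j. if j = i then c else 0)"
  unfolding square_summable_def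
  by (rule summable_on_cong_neutral[THEN iffD1, OF _ _ _ summable_on_finite[of "{i}"]]) auto

lemma square_summable_product:
  assumes "square_summable f" "square_summable g"
  shows "(\<lambda>i. cnj (f i) * g i) summable_on UNIV"
proof -
  have "(\<lambda>i. norm (cnj (f i) * g i)) summable_on UNIV"
  proof (rule summable_on_comparison_test)
    show "(\<lambda>i. (cmod (f i))\<^sup>2 + (cmod (g i))\<^sup>2) summable_on UNIV"
      using assms unfolding square_summable_def by (rule summable_on_add)
    fix i
    have "2 * (cmod (f i) * cmod (g i)) \<le> (cmod (f i))\<^sup>2 + (cmod (g i))\<^sup>2"
      using sum_squares_bound[of "cmod (f i)" "cmod (g i)"] by (simp add: mult.assoc)
    then show "norm (cnj (f i) * g i) \<le> (cmod (f i))\<^sup>2 + (cmod (g i))\<^sup>2"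
      using mult_nonneg_nonneg[OF norm_ge_zero[of "f i"] norm_ge_zero[of "g i"]]
      by (simp only: norm_mult complex_mod_cnj)
  qed auto
  then show ?thesis
    by (rule abs_summable_summable)
qed

typedef 'a ell2 = "{f :: 'a \<Rightarrow> complex. square_summable f}"
  using square_summable_zero by blast

setup_lifting type_definition_ell2

instantiation ell2 :: (type) real_vector
begin

lift_definition zero_ell2 :: "'a ell2" is "\<lambda>_. 0"
  by (rule square_summable_zero)

lift_definition plus_ell2 :: "'a ell2 \<Rightarrow> 'a ell2 \<Rightarrow> 'a ell2" is "\<lambda>f g i. f i + g i"
  by (rule square_summable_add)

lift_definition uminus_ell2 :: "'a ell2 \<Rightarrow> 'a ell2" is "\<lambda>f i. - f i"
  by (rule square_summable_uminus)

lift_definition minus_ell2 :: "'a ell2 \<Rightarrow> 'a ell2 \<Rightarrow> 'a ell2" is "\<lambda>f g i. f i - g i"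
  using square_summable_add[OF _ square_summable_uminus] by fastforce

lift_definition scaleR_ell2 :: "real \<Rightarrow> 'a ell2 \<Rightarrow> 'a ell2" is "\<lambda>r f i. complex_of_real r * f i"
  by (rule square_summable_mult)

instance
  by standard (transfer; simp add: fun_eq_iff algebra_simps; fail)+

end

lift_definition cscale :: "complex \<Rightarrow> 'a ell2 \<Rightarrow> 'a ell2" is "\<lambda>c f i. c * f i"
  by (rule square_summable_mult)

interpretation ell2: vector_space cscale
  by standard (transfer; simp add: fun_eq_iff algebra_simps; fail)+

lift_definition cinner :: "'a ell2 \<Rightarrow> 'a ell2 \<Rightarrow> complex" is
  "\<lambda>f g. \<Sum>\<^sub>\<infinity>i. cnj (f i) * g i" .

lemma cinner_add_left: "cinner (\<phi> + \<xi>) \<psi> = cinner \<phi> \<psi> + cinner \<xi> \<psi>"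
  by transfer (simp add: distrib_right infsum_add square_summable_product)

lemma cinner_cscale_left: "cinner (cscale c \<phi>) \<psi> = cnj c * cinner \<phi> \<psi>"
  by transfer (simp add: mult.assoc infsum_cmult_right')

lemma cinner_commute: "cinner \<phi> \<psi> = cnj (cinner \<psi> \<phi>)"
  by transfer (simp flip: infsum_cnj add: mult.commute)

lemma cinner_self: "cinner \<psi> \<psi> = of_real (\<Sum>\<^sub>\<infinity>i. (cmod (Rep_ell2 \<psi> i))\<^sup>2)"
proof -
  have "(\<lambda>i. (cmod (Rep_ell2 \<psi> i))\<^sup>2) summable_on UNIV"
    using Rep_ell2[of \<psi>] by (simp add: square_summable_def)
  then have "((\<lambda>i. complex_of_real ((cmod (Rep_ell2 \<psi> i))\<^sup>2)) has_sum
      of_real (\<Sum>\<^sub>\<infinity>i. (cmod (Rep_ell2 \<psi> i))\<^sup>2)) UNIV"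
    by (intro has_sum_of_real has_sum_infsum)
  then show ?thesis
    unfolding cinner.rep_eq by (intro infsumI) (simp add: complex_norm_square mult.commute del: of_real_power)
qed

lemma scaleR_eq_cscale: "r *\<^sub>R \<psi> = cscale (of_real r) \<psi>"
  by transfer simp

instantiation ell2 :: (type) real_inner
begin

definition inner_ell2 :: "'a ell2 \<Rightarrow> 'a ell2 \<Rightarrow> real" where
  "inner_ell2 \<phi> \<psi> = Re (cinner \<phi> \<psi>)"

definition norm_ell2 :: "'a ell2 \<Rightarrow> real" where
  "norm_ell2 \<psi> = sqrt (\<psi> \<bullet> \<psi>)"

definition dist_ell2 :: "'a ell2 \<Rightarrow> 'a ell2 \<Rightarrow> real" where
  "dist_ell2 \<phi> \<psi> = norm (\<phi> - \<psi>)"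

definition sgn_ell2 :: "'a ell2 \<Rightarrow> 'a ell2" where
  "sgn_ell2 \<psi> = \<psi> /\<^sub>R norm \<psi>"

definition uniformity_ell2 :: "('a ell2 \<times> 'a ell2) filter" where
  "uniformity_ell2 = (INF e\<in>{0<..}. principal {(\<phi>, \<psi>). dist \<phi> \<psi> < e})"

definition open_ell2 :: "'a ell2 set \<Rightarrow> bool" where
  "open_ell2 U \<longleftrightarrow> (\<forall>\<phi>\<in>U. eventually (\<lambda>(\<phi>', \<psi>). \<phi>' = \<phi> \<longrightarrow> \<psi> \<in> U) uniformity)"

instance
proof
  fix \<phi> \<psi> \<xi> :: "'a ell2" and r :: real and U :: "'a ell2 set"
  have *: "Re (cinner \<psi> \<psi>) = (\<Sum>\<^sub>\<infinity>i. (cmod (Rep_ell2 \<psi> i))\<^sup>2)"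
    by (simp add: cinner_self)
  have summable: "(\<lambda>i. (cmod (Rep_ell2 \<psi> i))\<^sup>2) summable_on UNIV"
    using Rep_ell2[of \<psi>] by (simp add: square_summable_def)
  show "dist \<phi> \<psi> = norm (\<phi> - \<psi>)"
    by (rule dist_ell2_def)
  show "sgn \<psi> = \<psi> /\<^sub>R norm \<psi>"
    by (rule sgn_ell2_def)
  show "(uniformity :: ('a ell2 \<times> 'a ell2) filter) =
      (INF e\<in>{0<..}. principal {(\<phi>, \<psi>). dist \<phi> \<psi> < e})"
    by (rule uniformity_ell2_def)
  show "open U \<longleftrightarrow> (\<forall>\<phi>\<in>U. eventually (\<lambda>(\<phi>', \<psi>). \<phi>' = \<phi> \<longrightarrow> \<psi> \<in> U) uniformity)"
    by (rule open_ell2_def)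
  show "\<phi> \<bullet> \<psi> = \<psi> \<bullet> \<phi>"
    unfolding inner_ell2_def by (subst cinner_commute) simp
  show "(\<phi> + \<xi>) \<bullet> \<psi> = \<phi> \<bullet> \<psi> + \<xi> \<bullet> \<psi>"
    by (simp add: inner_ell2_def cinner_add_left)
  show "(r *\<^sub>R \<phi>) \<bullet> \<psi> = r * (\<phi> \<bullet> \<psi>)"
    by (simp add: inner_ell2_def scaleR_eq_cscale cinner_cscale_left)
  show "0 \<le> \<psi> \<bullet> \<psi>"
    by (simp add: inner_ell2_def * infsum_nonneg)
  show "\<psi> \<bullet> \<psi> = 0 \<longleftrightarrow> \<psi> = 0"
  proof
    assume "\<psi> \<bullet> \<psi> = 0"
    then have "(cmod (Rep_ell2 \<psi> i))\<^sup>2 = 0" for i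
      using nonneg_infsum_le_0D[OF _ summable] by (simp add: inner_ell2_def *)
    then show "\<psi> = 0"
      by (simp add: zero_ell2.rep_eq fun_eq_iff flip: Rep_ell2_inject)
  next
    assume "\<psi> = 0"
    then show "\<psi> \<bullet> \<psi> = 0"
      by (simp add: inner_ell2_def cinner.rep_eq zero_ell2.rep_eq)
  qed
  show "norm \<psi> = sqrt (\<psi> \<bullet> \<psi>)"
    by (rule norm_ell2_def)
qed

end

lift_definition ket :: "'a \<Rightarrow> 'a ell2" is "\<lambda>i j. if j = i then 1 else 0"
  by (rule square_summable_single)


section \<open>Operators, trace norm, density operators\<close>

definition bounded_op :: "('a ell2 \<Rightarrow> 'a ell2) \<Rightarrow> bool" where
  "bounded_op A \<longleftrightarrow> bounded_linear A \<and> (\<forall>c \<psi>. A (cscale c \<psi>) = cscale c (A \<psi>))"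

definition positive_op :: "('a ell2 \<Rightarrow> 'a ell2) \<Rightarrow> bool" where
  "positive_op A \<longleftrightarrow> bounded_op A \<and> (\<forall>\<psi>. cinner \<psi> (A \<psi>) \<in> \<real> \<and> 0 \<le> Re (cinner \<psi> (A \<psi>)))"

definition adj :: "('a ell2 \<Rightarrow> 'a ell2) \<Rightarrow> 'a ell2 \<Rightarrow> 'a ell2" where
  "adj A = (THE B. bounded_op B \<and> (\<forall>\<phi> \<psi>. cinner (B \<phi>) \<psi> = cinner \<phi> (A \<psi>)))"

definition abs_op :: "('a ell2 \<Rightarrow> 'a ell2) \<Rightarrow> 'a ell2 \<Rightarrow> 'a ell2" where
  "abs_op A = (THE P. positive_op P \<and> P \<circ> P = adj A \<circ> A)"

text \<open>The trace of a positive operator, with value \<open>\<infinity>\<close> unless the operator is trace class.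
  Hence the trace norm below is also \<open>\<infinity>\<close> on bounded operators that are not trace class.\<close>

definition pos_trace :: "('a ell2 \<Rightarrow> 'a ell2) \<Rightarrow> ennreal" where
  "pos_trace P = (\<Sum>\<^sub>\<infinity>i. ennreal (Re (cinner (ket i) (P (ket i)))))"

definition trace_norm :: "('a ell2 \<Rightarrow> 'a ell2) \<Rightarrow> ennreal" where
  "trace_norm A = pos_trace (abs_op A)"

definition trace_distance :: "('a ell2 \<Rightarrow> 'a ell2) \<Rightarrow> ('a ell2 \<Rightarrow> 'a ell2) \<Rightarrow> ennreal" where
  "trace_distance \<rho> \<sigma> = trace_norm (\<lambda>\<psi>. \<rho> \<psi> - \<sigma> \<psi>) / 2"

definition density_op :: "('a ell2 \<Rightarrow> 'a ell2) \<Rightarrow> bool" where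
  "density_op \<rho> \<longleftrightarrow> positive_op \<rho> \<and> pos_trace \<rho> = 1"

definition pure_state :: "'a ell2 \<Rightarrow> 'a ell2 \<Rightarrow> 'a ell2" where
  "pure_state \<psi> \<phi> = cscale (cinner \<psi> \<phi>) \<psi>"


section \<open>Two-mode bosonic Fock space\<close>

text \<open>The number state with \<open>m\<close> photons in Alice's mode and \<open>n\<close> photons in Bob's mode is
  \<open>ket (m, n)\<close>.\<close>

type_synonym fock = "(nat \<times> nat) ell2"

definition vacuum :: fock where
  "vacuum = ket (0, 0)"

text \<open>The ladder operators are unbounded. They act on the coefficients in the number basis, and
  are meant on the vectors for which the resulting family is square summable (in particular, on
  all vectors of finite photon number). Elsewhere they are set to \<open>0\<close>.\<close>

definition ell2_of :: "('a \<Rightarrow> complex) \<Rightarrow> 'a ell2" where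
  "ell2_of f = (if square_summable f then Abs_ell2 f else 0)"

definition create_a :: "fock \<Rightarrow> fock" where
  "create_a \<psi> = ell2_of (\<lambda>(m, n). of_real (sqrt (real m)) * Rep_ell2 \<psi> (m - 1, n))"

definition create_b :: "fock \<Rightarrow> fock" where
  "create_b \<psi> = ell2_of (\<lambda>(m, n). of_real (sqrt (real n)) * Rep_ell2 \<psi> (m, n - 1))"

definition annihilate_a :: "fock \<Rightarrow> fock" where
  "annihilate_a \<psi> = ell2_of (\<lambda>(m, n). of_real (sqrt (real (m + 1))) * Rep_ell2 \<psi> (m + 1, n))"

definition annihilate_b :: "fock \<Rightarrow> fock" where
  "annihilate_b \<psi> = ell2_of (\<lambda>(m, n). of_real (sqrt (real (n + 1))) * Rep_ell2 \<psi> (m, n + 1))"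

definition number_a :: "fock \<Rightarrow> fock" where
  "number_a \<psi> = create_a (annihilate_a \<psi>)"

definition number_b :: "fock \<Rightarrow> fock" where
  "number_b \<psi> = create_b (annihilate_b \<psi>)"

text \<open>The unitaries \<open>(-1)\<^sup>x\<^sup>N\<close>, by functional calculus for the number operators, which are
  diagonal in the number basis (see \<open>number_a_ket\<close> and \<open>number_b_ket\<close>). Conjugation by them gives
  the phase operations on the creation operators (see \<open>phase_a_create_a\<close> and
  \<open>phase_b_create_b\<close>).\<close>

definition phase_a :: "nat \<Rightarrow> fock \<Rightarrow> fock" where
  "phase_a x \<psi> = ell2_of (\<lambda>(m, n). (-1) ^ (x * m) * Rep_ell2 \<psi> (m, n))"

definition phase_b :: "nat \<Rightarrow> fock \<Rightarrow> fock" where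
  "phase_b y \<psi> = ell2_of (\<lambda>(m, n). (-1) ^ (y * n) * Rep_ell2 \<psi> (m, n))"

lemma Rep_ell2_of: "square_summable f \<Longrightarrow> Rep_ell2 (ell2_of f) = f"
  by (simp add: ell2_of_def Abs_ell2_inverse)

lemma cscale_ket: "cscale c (ket i) = ell2_of (\<lambda>j. if j = i then c else 0)"
  by (simp add: cscale.rep_eq ket.rep_eq fun_eq_iff Rep_ell2_of square_summable_single
      flip: Rep_ell2_inject)

lemma create_a_ket: "create_a (ket (m, n)) = cscale (of_real (sqrt (real (m + 1)))) (ket (m + 1, n))"
  unfolding create_a_def cscale_ket
  by (rule arg_cong[of _ _ ell2_of]) (auto simp: fun_eq_iff ket.rep_eq split: nat_diff_split)

lemma create_b_ket: "create_b (ket (m, n)) = cscale (of_real (sqrt (real (n + 1)))) (ket (m, n + 1))"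
  unfolding create_b_def cscale_ket
  by (rule arg_cong[of _ _ ell2_of]) (auto simp: fun_eq_iff ket.rep_eq split: nat_diff_split)

lemma number_a_ket: "number_a (ket (m, n)) = cscale (of_nat m) (ket (m, n))"
proof -
  have "annihilate_a (ket (m, n)) =
      ell2_of (\<lambda>j. if j = (m - 1, n) then of_real (sqrt (real m)) else 0)"
    unfolding annihilate_a_def
    by (rule arg_cong[of _ _ ell2_of]) (auto simp: fun_eq_iff ket.rep_eq)
  then show ?thesis
    unfolding number_a_def create_a_def cscale_ket
    by (simp add: Rep_ell2_of square_summable_single)
      (rule arg_cong[of _ _ ell2_of], cases m,
        auto simp: fun_eq_iff simp flip: of_real_mult split: nat_diff_split)
qed

lemma number_b_ket: "number_b (ket (m, n)) = cscale (of_nat n) (ket (m, n))"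
proof -
  have "annihilate_b (ket (m, n)) =
      ell2_of (\<lambda>j. if j = (m, n - 1) then of_real (sqrt (real n)) else 0)"
    unfolding annihilate_b_def
    by (rule arg_cong[of _ _ ell2_of]) (auto simp: fun_eq_iff ket.rep_eq)
  then show ?thesis
    unfolding number_b_def create_b_def cscale_ket
    by (simp add: Rep_ell2_of square_summable_single)
      (rule arg_cong[of _ _ ell2_of], cases n,
        auto simp: fun_eq_iff simp flip: of_real_mult split: nat_diff_split)
qed

lemma Rep_phase_a: "Rep_ell2 (phase_a x \<psi>) (m, n) = (-1) ^ (x * m) * Rep_ell2 \<psi> (m, n)"
proof -
  have "square_summable (\<lambda>(m, n). (-1) ^ (x * m) * Rep_ell2 \<psi> (m, n))"
    using Rep_ell2[of \<psi>]
    by (simp add: square_summable_def case_prod_unfold norm_mult norm_power)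
  then show ?thesis
    by (simp add: phase_a_def Rep_ell2_of)
qed

lemma Rep_phase_b: "Rep_ell2 (phase_b y \<psi>) (m, n) = (-1) ^ (y * n) * Rep_ell2 \<psi> (m, n)"
proof -
  have "square_summable (\<lambda>(m, n). (-1) ^ (y * n) * Rep_ell2 \<psi> (m, n))"
    using Rep_ell2[of \<psi>]
    by (simp add: square_summable_def case_prod_unfold norm_mult norm_power)
  then show ?thesis
    by (simp add: phase_b_def Rep_ell2_of)
qed

lemma ell2_of_mult: "c \<noteq> 0 \<Longrightarrow> ell2_of (\<lambda>i. c * f i) = cscale c (ell2_of f)"
proof (cases "square_summable f")
  case True
  then show ?thesis
    by (simp add: cscale.rep_eq Rep_ell2_of square_summable_mult flip: Rep_ell2_inject)
next
  case False
  assume c: "c \<noteq> 0"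
  have "\<not> square_summable (\<lambda>i. c * f i)"
    using False square_summable_mult[of "\<lambda>i. c * f i" "inverse c"] c by (auto simp flip: mult.assoc)
  then show ?thesis
    using False by (simp add: ell2_of_def)
qed

lemma phase_a_eqI:
  assumes "\<And>m n. g (m, n) = (-1) ^ (x * m) * f (m, n)"
  shows "phase_a x (ell2_of f) = ell2_of g"
proof -
  have iff: "square_summable g = square_summable f"
    using assms by (auto simp: square_summable_def norm_mult norm_power intro!: summable_on_cong)
  show ?thesis
  proof (cases "square_summable f")
    case True
    then show ?thesis
      using assms iff by (auto simp: Rep_phase_a Rep_ell2_of fun_eq_iff simp flip: Rep_ell2_inject)
  next
    case False
    then have "ell2_of f = 0" "ell2_of g = 0"
      using iff by (auto simp: ell2_of_def)
    then show ?thesis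
      by (auto simp: Rep_phase_a zero_ell2.rep_eq fun_eq_iff simp flip: Rep_ell2_inject)
  qed
qed

lemma phase_b_eqI:
  assumes "\<And>m n. g (m, n) = (-1) ^ (y * n) * f (m, n)"
  shows "phase_b y (ell2_of f) = ell2_of g"
proof -
  have iff: "square_summable g = square_summable f"
    using assms by (auto simp: square_summable_def norm_mult norm_power intro!: summable_on_cong)
  show ?thesis
  proof (cases "square_summable f")
    case True
    then show ?thesis
      using assms iff by (auto simp: Rep_phase_b Rep_ell2_of fun_eq_iff simp flip: Rep_ell2_inject)
  next
    case False
    then have "ell2_of f = 0" "ell2_of g = 0"
      using iff by (auto simp: ell2_of_def)
    then show ?thesis
      by (auto simp: Rep_phase_b zero_ell2.rep_eq fun_eq_iff simp flip: Rep_ell2_inject)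
  qed
qed

lemma phase_a_create_a: "phase_a x (create_a (phase_a x \<psi>)) = cscale ((-1) ^ x) (create_a \<psi>)"
proof -
  have eq: "((-1) ^ x * of_real (sqrt (real m)) :: complex) =
      (-1) ^ (x * m) * (of_real (sqrt (real m)) * (-1) ^ (x * (m - 1)))" for m
    by (cases m) (simp_all add: power_add flip: power_mult_distrib)
  have "cscale ((-1) ^ x) (create_a \<psi>) = ell2_of
      (\<lambda>i. (-1) ^ x * (case i of (m, n) \<Rightarrow> of_real (sqrt (real m)) * Rep_ell2 \<psi> (m - 1, n)))"
    unfolding create_a_def by (rule ell2_of_mult[symmetric]) simp
  also have "\<dots> = phase_a x (create_a (phase_a x \<psi>))"
    unfolding create_a_def
    by (rule phase_a_eqI[symmetric]) (use eq in \<open>simp add: Rep_phase_a flip: mult.assoc\<close>)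
  finally show ?thesis ..
qed

lemma phase_b_create_b: "phase_b y (create_b (phase_b y \<psi>)) = cscale ((-1) ^ y) (create_b \<psi>)"
proof -
  have eq: "((-1) ^ y * of_real (sqrt (real n)) :: complex) =
      (-1) ^ (y * n) * (of_real (sqrt (real n)) * (-1) ^ (y * (n - 1)))" for n
    by (cases n) (simp_all add: power_add flip: power_mult_distrib)
  have "cscale ((-1) ^ y) (create_b \<psi>) = ell2_of
      (\<lambda>i. (-1) ^ y * (case i of (m, n) \<Rightarrow> of_real (sqrt (real n)) * Rep_ell2 \<psi> (m, n - 1)))"
    unfolding create_b_def by (rule ell2_of_mult[symmetric]) simp
  also have "\<dots> = phase_b y (create_b (phase_b y \<psi>))"
    unfolding create_b_def
    by (rule phase_b_eqI[symmetric]) (use eq in \<open>simp add: Rep_phase_b flip: mult.assoc\<close>)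
  finally show ?thesis ..
qed


section \<open>Resource states and the protocol\<close>

definition fixed_number_space :: "nat \<Rightarrow> fock set" where
  "fixed_number_space n =
    ell2.span {(create_a ^^ k) ((create_b ^^ (n - k)) vacuum) | k. k \<le> n}"

text \<open>Stating that the minimum over \<open>n\<close> and \<open>\<psi>\<close> is at most \<open>\<nu>\<close> means that some pair
  \<open>n\<close>, \<open>\<psi>\<close> achieves distance at most \<open>\<nu>\<close>.\<close>

definition security_parameter :: "(fock \<Rightarrow> fock) \<Rightarrow> real \<Rightarrow> bool" where
  "security_parameter \<rho> \<nu> \<longleftrightarrow>
    (\<exists>n. \<exists>\<psi>\<in>fixed_number_space n. norm \<psi> = 1 \<and> trace_distance (pure_state \<psi>) \<rho> \<le> ennreal \<nu>)"

definition lossy :: "real \<Rightarrow> (fock \<Rightarrow> fock) \<Rightarrow> fock \<Rightarrow> fock" where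
  "lossy loss \<rho> \<psi> = (1 - loss) *\<^sub>R \<rho> \<psi> + loss *\<^sub>R pure_state vacuum \<psi>"

definition encode :: "nat \<Rightarrow> nat \<Rightarrow> fock \<Rightarrow> fock" where
  "encode x y = phase_a x \<circ> phase_b y"

definition eavesdropper_state :: "(fock \<Rightarrow> fock) \<Rightarrow> nat \<Rightarrow> fock \<Rightarrow> fock" where
  "eavesdropper_state \<rho> x \<psi> =
    (1/2) *\<^sub>R (\<Sum>y\<in>{0, 1}. (encode x y \<circ> \<rho> \<circ> adj (encode x y)) \<psi>)"

text \<open>\<open>protocol_secure \<delta> \<rho>\<close>: the protocol run with the resource state \<open>\<rho>\<close> is
  \<open>(1 - \<delta>)\<close>-secure.\<close>

definition protocol_secure :: "real \<Rightarrow> (fock \<Rightarrow> fock) \<Rightarrow> bool" where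
  "protocol_secure \<delta> \<rho> \<longleftrightarrow>
    (\<exists>\<tau>. density_op \<tau> \<and>
      (\<forall>x\<in>{0, 1}. trace_distance \<tau> (eavesdropper_state \<rho> x) \<le> ennreal \<delta>))"

end

theory Submission
  imports Defs "HOL-Computational_Algebra.Polynomial"
begin

text \<open>
  The encoding \<open>U\<^bsub>x,y\<^esub>\<close> acts on a pure state \<open>\<psi>\<close> with \<open>n\<close> photons such that \<open>U\<^bsub>1,y\<^esub> \<psi>\<close> and
  \<open>U\<^bsub>0,1-y\<^esub> \<psi>\<close> agree up to the sign \<open>(-1)\<^sup>n\<close>. Hence the eavesdropper's state for the ideal
  resource \<open>(1 - \<lambda>) |\<psi>\<rangle>\<langle>\<psi>| + \<lambda> |0\<rangle>\<langle>0|\<close> does not depend on \<open>x\<close> (the vacuum is the case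
  \<open>n = 0\<close>), and it serves as \<open>\<tau>\<close>. The vacuum parts cancel in \<open>\<tau> - \<sigma>\<^sub>x\<close>, which is \<open>1 - \<lambda>\<close> times an
  average of conjugates of \<open>A = |\<psi>\<rangle>\<langle>\<psi>| - \<rho>\<close> by unitaries, so its trace norm is at most
  \<open>(1 - \<lambda>) \<parallel>A\<parallel>\<^sub>1\<close>.

  For this last bound, the average \<open>B\<close> satisfies \<open>-R \<le> B \<le> R\<close>, where \<open>R\<close> is the same average of
  conjugates of \<open>|A|\<close>. Polarization gives \<open>\<langle>\<phi>, B \<psi>\<rangle> \<le> (\<langle>\<phi>, R \<phi>\<rangle> + \<langle>\<psi>, R \<psi>\<rangle>) / 2\<close>. With self-adjoint
  contractions \<open>S\<^sub>n\<close> such that \<open>S\<^sub>n B \<rightarrow> |B|\<close> strongly, this yields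
  \<open>tr |B| \<le> (tr S\<^sub>n R S\<^sub>n + tr R) / 2 \<le> tr R\<close> in the limit. Square roots and the approximate signs
  \<open>S\<^sub>n\<close> come from one recursion on real polynomials.
\<close>

section \<open>Polynomials of symmetric operators\<close>

text \<open>Only the real inner product enters, so that real polynomials suffice; complex linearity
  is recovered later from commutation with \<open>cscale\<close>.\<close>

definition symmetric_op :: "('a::real_inner \<Rightarrow> 'a) \<Rightarrow> bool" where
  "symmetric_op A \<longleftrightarrow> bounded_linear A \<and> (\<forall>x y. A x \<bullet> y = x \<bullet> A y)"

definition psd :: "('a::real_inner \<Rightarrow> 'a) \<Rightarrow> bool" where
  "psd A \<longleftrightarrow> symmetric_op A \<and> (\<forall>x. 0 \<le> x \<bullet> A x)"

definition poly_op :: "('a::real_vector \<Rightarrow> 'a) \<Rightarrow> real poly \<Rightarrow> 'a \<Rightarrow> 'a" where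
  "poly_op A p x = (\<Sum>i\<le>degree p. coeff p i *\<^sub>R (A ^^ i) x)"

lemma poly_op_altdef:
  assumes "degree p \<le> n"
  shows "poly_op A p x = (\<Sum>i\<le>n. coeff p i *\<^sub>R (A ^^ i) x)"
  unfolding poly_op_def using assms
  by (intro sum.mono_neutral_left) (auto simp: coeff_eq_0)

lemma poly_op_0 [simp]: "poly_op A 0 x = 0"
  by (simp add: poly_op_def)

lemma poly_op_1 [simp]: "poly_op A 1 x = x"
  by (simp add: poly_op_def)

lemma poly_op_add: "poly_op A (p + q) x = poly_op A p x + poly_op A q x"
proof -
  let ?n = "max (degree p) (degree q)"
  have "degree (p + q) \<le> ?n" by (rule degree_add_le_max)
  then show ?thesis
    by (simp add: poly_op_altdef[of _ ?n] scaleR_left_distrib sum.distrib)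
qed

lemma poly_op_smult: "poly_op A (smult c p) x = c *\<^sub>R poly_op A p x"
  by (simp add: poly_op_altdef[of _ "degree p"] scaleR_sum_right)

lemma poly_op_diff: "poly_op A (p - q) x = poly_op A p x - poly_op A q x"
  using poly_op_add[of A "p - q" q x] by simp

lemma poly_op_pCons:
  assumes "linear A"
  shows "poly_op A (pCons a p) x = a *\<^sub>R x + A (poly_op A p x)"
proof -
  have "degree (pCons a p) \<le> Suc (degree p)" by (rule degree_pCons_le)
  then have "poly_op A (pCons a p) x = (\<Sum>i\<le>Suc (degree p). coeff (pCons a p) i *\<^sub>R (A ^^ i) x)"
    by (rule poly_op_altdef)
  also have "\<dots> = a *\<^sub>R x + (\<Sum>i\<le>degree p. coeff p i *\<^sub>R A ((A ^^ i) x))"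
    by (simp add: sum.atMost_Suc_shift del: sum.atMost_Suc)
  finally show ?thesis
    by (simp add: poly_op_def linear_sum[OF assms] linear_scale[OF assms])
qed

lemma poly_op_X: "linear A \<Longrightarrow> poly_op A [:0, 1:] x = A x"
  by (simp add: poly_op_pCons linear_0)

lemma poly_op_mult:
  assumes "linear A"
  shows "poly_op A (p * q) x = poly_op A p (poly_op A q x)"
proof (induction p)
  case (pCons a p)
  then show ?case
    by (simp add: mult_pCons_left poly_op_add poly_op_smult poly_op_pCons assms)
qed simp

lemma bounded_linear_poly_op:
  assumes "bounded_linear A"
  shows "bounded_linear (poly_op A p)"
proof (induction p)
  case 0
  have "poly_op A 0 = (\<lambda>_. 0)" by auto
  then show ?case by (simp add: bounded_linear_zero)
next
  case (pCons a p)
  have "poly_op A (pCons a p) = (\<lambda>x. a *\<^sub>R x + A (poly_op A p x))"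
    by (rule ext) (simp add: poly_op_pCons bounded_linear.linear assms)
  then show ?case
    using bounded_linear_add[OF bounded_linear_scaleR_right bounded_linear_compose[OF assms pCons.IH]]
    by simp
qed

lemma poly_op_commute:
  assumes "linear A" "linear C" "\<And>x. C (A x) = A (C x)"
  shows "C (poly_op A p x) = poly_op A p (C x)"
proof (induction p)
  case 0
  then show ?case using assms(2) by (simp add: linear_0)
next
  case (pCons a p)
  then show ?case
    by (simp add: poly_op_pCons assms linear_add[OF assms(2)] linear_scale[OF assms(2)])
qed

section \<open>Symmetric and positive operators under polynomial calculus\<close>

lemma symmetric_op_bounded_linear: "symmetric_op A \<Longrightarrow> bounded_linear A"
  by (simp add: symmetric_op_def)

lemma symmetric_op_linear: "symmetric_op A \<Longrightarrow> linear A"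
  by (simp add: symmetric_op_def bounded_linear.linear)

lemma symmetric_opD: "symmetric_op A \<Longrightarrow> A x \<bullet> y = x \<bullet> A y"
  by (simp add: symmetric_op_def)

lemma psd_symmetric_op: "psd A \<Longrightarrow> symmetric_op A"
  by (simp add: psd_def)

lemma psd_nonneg: "psd A \<Longrightarrow> 0 \<le> x \<bullet> A x"
  by (simp add: psd_def)

lemma symmetric_op_poly_op:
  assumes "symmetric_op A"
  shows "symmetric_op (poly_op A p)"
proof -
  note lin = symmetric_op_linear[OF assms]
  have "poly_op A p x \<bullet> y = x \<bullet> poly_op A p y" for x y
  proof (induction p arbitrary: x y)
    case (pCons a p)
    have "A (poly_op A p x) \<bullet> y = x \<bullet> A (poly_op A p y)"
      by (simp add: symmetric_opD[OF assms] pCons.IH poly_op_commute[OF lin lin])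
    then show ?case
      by (simp add: poly_op_pCons lin inner_add_left inner_add_right)
  qed simp
  then show ?thesis
    using bounded_linear_poly_op[OF symmetric_op_bounded_linear[OF assms]]
    by (simp add: symmetric_op_def)
qed

text \<open>One factor \<open>g\<close> moves across the inner product, so positivity of
  \<open>m\<close> at \<open>A\<close> passes to \<open>g * m * g\<close>.\<close>

lemma inner_poly_op_sandwich:
  assumes "symmetric_op A"
  shows "x \<bullet> poly_op A (g * m * g) x = poly_op A g x \<bullet> poly_op A m (poly_op A g x)"
  by (simp add: poly_op_mult symmetric_op_linear assms symmetric_opD[OF symmetric_op_poly_op[OF assms]])

lemma norm_poly_op_square:
  assumes "symmetric_op A"
  shows "(norm (poly_op A g x))\<^sup>2 = x \<bullet> poly_op A (g * g) x"
  using inner_poly_op_sandwich[OF assms, of x g 1] by (simp add: power2_norm_eq_inner)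

text \<open>
  If \<open>t\<close> and \<open>1 - t\<close> evaluate to positive operators at \<open>A\<close>, then so does every member of this cone
  (\<open>poly_cone_nonneg\<close>). This replaces the spectral theorem.
\<close>

inductive_set poly_cone :: "real poly \<Rightarrow> real poly set" for t where
  poly_cone_1: "1 \<in> poly_cone t"
| poly_cone_t: "f \<in> poly_cone t \<Longrightarrow> t * f \<in> poly_cone t"
| poly_cone_1_t: "f \<in> poly_cone t \<Longrightarrow> (1 - t) * f \<in> poly_cone t"
| poly_cone_add: "f \<in> poly_cone t \<Longrightarrow> g \<in> poly_cone t \<Longrightarrow> f + g \<in> poly_cone t"
| poly_cone_smult: "f \<in> poly_cone t \<Longrightarrow> 0 \<le> c \<Longrightarrow> smult c f \<in> poly_cone t"

lemma poly_cone_mult: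
  assumes "f \<in> poly_cone t" "g \<in> poly_cone t"
  shows "f * g \<in> poly_cone t"
  using assms(1)
proof induction
  case (poly_cone_add f h)
  then show ?case by (simp add: distrib_right poly_cone.poly_cone_add)
qed (auto simp: assms(2) mult.assoc intro: poly_cone.intros)

lemma poly_cone_0: "0 \<in> poly_cone t"
  using poly_cone_smult[OF poly_cone_1, of 0 t] by simp

lemma poly_cone_base: "t \<in> poly_cone t" "1 - t \<in> poly_cone t"
  using poly_cone_t[OF poly_cone_1] poly_cone_1_t[OF poly_cone_1] by simp_all

lemma poly_cone_nonneg:
  assumes A: "symmetric_op A"
    and t: "\<And>x. 0 \<le> x \<bullet> poly_op A t x" "\<And>x. 0 \<le> x \<bullet> poly_op A (1 - t) x"
    and "f \<in> poly_cone t"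
  shows "0 \<le> x \<bullet> poly_op A f x"
proof -
  \<comment> \<open>The product of the two positive elements becomes a sum of sandwiches
    \<open>g * m * g\<close> with \<open>m\<close> equal to \<open>t\<close> or
    \<open>1 - t\<close>.\<close>
  have prod: "0 \<le> x \<bullet> poly_op A (t * (1 - t)) x" for x
  proof -
    have eq: "t * (1 - t) = t * (1 - t) * t + (1 - t) * t * (1 - t)"
      by (simp add: algebra_simps)
    show ?thesis
      by (subst eq) (simp add: poly_op_add inner_add_right inner_poly_op_sandwich[OF A] t)
  qed
  have base: "0 \<le> x \<bullet> poly_op A (t ^ a * (1 - t) ^ b) x" for a b
  proof -
    \<comment> \<open>The even parts of the exponents form the outer factor \<open>g\<close>; only
      the parities remain in \<open>m\<close>.\<close>
    have "\<exists>g m. t ^ a * (1 - t) ^ b = g * m * g \<and> m \<in> {1, t, 1 - t, t * (1 - t)}"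
    proof (intro exI conjI)
      let ?g = "t ^ (a div 2) * (1 - t) ^ (b div 2)"
      let ?m = "t ^ (a mod 2) * (1 - t) ^ (b mod 2)"
      have "t ^ a = t ^ (a div 2) * t ^ (a mod 2) * t ^ (a div 2)"
        by (metis (no_types) div_mult_mod_eq mult_2_right power_add mult.assoc mult.commute)
      moreover have "(1 - t) ^ b = (1 - t) ^ (b div 2) * (1 - t) ^ (b mod 2) * (1 - t) ^ (b div 2)"
        by (metis (no_types) div_mult_mod_eq mult_2_right power_add mult.assoc mult.commute)
      ultimately show "t ^ a * (1 - t) ^ b = ?g * ?m * ?g"
        by (simp only: ac_simps)
      show "?m \<in> {1, t, 1 - t, t * (1 - t)}"
        by (cases "even a"; cases "even b") (simp_all add: odd_iff_mod_2_eq_one)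
    qed
    then show ?thesis
      by (elim exE conjE) (auto simp: inner_poly_op_sandwich[OF A] t prod simp del: mult_1_right)
  qed
  \<comment> \<open>The hypothesis for \<open>f\<close> alone does not directly yield
    \<open>t * f\<close>, so the induction carries an arbitrary monomial and absorbs each generator
    into its exponents.\<close>
  have "0 \<le> x \<bullet> poly_op A (t ^ a * (1 - t) ^ b * f) x" for a b
    using assms(4)
  proof (induction arbitrary: a b)
    case poly_cone_1
    then show ?case using base by simp
  next
    case (poly_cone_t f)
    then show ?case using poly_cone_t.IH[of "Suc a" b] by (simp add: ac_simps)
  next
    case (poly_cone_1_t f)
    then show ?case using poly_cone_1_t.IH[of a "Suc b"] by (simp add: ac_simps)
  next
    case (poly_cone_add f g)
    then show ?case by (simp add: distrib_left poly_op_add inner_add_right)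
  next
    case (poly_cone_smult f c)
    then show ?case by (simp add: poly_op_smult)
  qed
  from this[of 0 0] show ?thesis by simp
qed

text \<open>
  With \<open>p\<^sub>n = t * sqrt_quot t n\<close> this is the classical iteration
  \<open>p\<^bsub>n+1\<^esub> = p\<^sub>n + (t - p\<^sub>n\<^sup>2) / 2\<close> converging to the square root of \<open>t\<close> on \<open>[0, 1]\<close>. The factor \<open>t\<close> is
  split off because for \<open>t = a\<^sup>2\<close> the polynomials \<open>a * sqrt_quot t n\<close> approximate the sign of \<open>a\<close>.
\<close>

primrec sqrt_quot :: "real poly \<Rightarrow> nat \<Rightarrow> real poly" where
  "sqrt_quot t 0 = 0"
| "sqrt_quot t (Suc n) = sqrt_quot t n + smult (1/2) (1 - t * (sqrt_quot t n)\<^sup>2)"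

text \<open>For p = \<open>t * sqrt_quot t n\<close> the first two claims encode p <= 1 and, with a
  factor \<open>t\<close> cancelled, p^2 <= t. They are proved together: from Y and Z the recursion
  makes ((1 - t) + Y^2) / 2 and Z (Y/2 + (Y^2 + 1 - t)/4).\<close>

lemma sqrt_quot_cone:
  "1 - t * sqrt_quot t n \<in> poly_cone t \<and> 1 - t * (sqrt_quot t n)\<^sup>2 \<in> poly_cone t \<and> sqrt_quot t n \<in> poly_cone t"
proof (induction n)
  case 0
  then show ?case by (simp add: poly_cone_0 poly_cone_1)
next
  case (Suc n)
  let ?q = "sqrt_quot t n"
  let ?Y = "1 - t * ?q" and ?Z = "1 - t * ?q\<^sup>2"
  \<comment> \<open>A constant polynomial with 2h = 1 replaces \<open>smult (1/2)\<close>, which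
    leaves ring identities for \<open>algebra\<close>.\<close>
  define h where "h = ([:1/2:] :: real poly)"
  have h: "smult (1/2) p = h * p" "h + h = 1" for p :: "real poly"
    by (simp_all add: h_def one_pCons)
  have h2: "h * 2 = 1" using h(2) by (simp add: mult_2_right)
  have q: "sqrt_quot t (Suc n) = ?q + h * ?Z" by (simp add: h)
  have "1 - t * (?q + h * ?Z) = h * ((1 - t) + ?Y * ?Y)"
    using h2 by algebra
  then have "1 - t * sqrt_quot t (Suc n) = smult (1/2) ((1 - t) + ?Y * ?Y)"
    unfolding q h(1) .
  moreover have "1 - t * (?q + h * ?Z)\<^sup>2 = ?Z * (h * ?Y + h * (h * (?Y * ?Y + (1 - t))))"
    using h2 by algebra
  then have "1 - t * (sqrt_quot t (Suc n))\<^sup>2 =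
      ?Z * (smult (1/2) ?Y + smult (1/2) (smult (1/2) (?Y * ?Y + (1 - t))))"
    unfolding q h(1) .
  ultimately show ?case
    using Suc by (auto intro!: poly_cone_add poly_cone_smult poly_cone_mult poly_cone_base)
qed

text \<open>The approximants increase: each increment is half of
  \<open>t * (1 - t * (sqrt_quot t n)\<^sup>2)\<close>.\<close>

lemma sqrt_quot_diff_cone:
  assumes "m \<le> n"
  shows "t * sqrt_quot t n - t * sqrt_quot t m \<in> poly_cone t"
  using assms
proof (induction n rule: dec_induct)
  case base
  then show ?case by (simp add: poly_cone_0)
next
  case (step n)
  have "t * sqrt_quot t (Suc n) - t * sqrt_quot t m =
      (t * sqrt_quot t n - t * sqrt_quot t m) + smult (1/2) (t * (1 - t * (sqrt_quot t n)\<^sup>2))"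
    by (simp add: algebra_simps)
  moreover have "\<dots> \<in> poly_cone t"
    using step sqrt_quot_cone[of t n] by (auto intro!: poly_cone_add poly_cone_smult poly_cone_mult poly_cone_base)
  ultimately show ?case by (simp only:)
qed


section \<open>Square roots and approximate signs\<close>

text \<open>Operator and polynomial are separate parameters because two instances occur: t = X for
  roots of a positive operator, and t = X^2 for a symmetric operator whose sign is
  approximated.\<close>

locale unit_interval_op =
  fixes A :: "'a :: {real_inner, complete_space} \<Rightarrow> 'a" and t :: "real poly"
  assumes symmetric: "symmetric_op A"
    and nonneg: "0 \<le> x \<bullet> poly_op A t x"
    and le_one: "0 \<le> x \<bullet> poly_op A (1 - t) x"
begin

lemma poly_op_nonneg: "f \<in> poly_cone t \<Longrightarrow> 0 \<le> x \<bullet> poly_op A f x"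
  by (rule poly_cone_nonneg[OF symmetric nonneg le_one])

lemma poly_op_mono:
  assumes "g - f \<in> poly_cone t"
  shows "x \<bullet> poly_op A f x \<le> x \<bullet> poly_op A g x"
  using poly_op_nonneg[OF assms, of x] by (simp add: poly_op_diff inner_diff_right)

text \<open>This is f^2 <= f for 0 <= f <= 1. It lets quadratic forms control norms of
  vectors.\<close>

lemma norm_poly_op_square_le:
  assumes "f \<in> poly_cone t" "1 - f \<in> poly_cone t"
  shows "(norm (poly_op A f x))\<^sup>2 \<le> x \<bullet> poly_op A f x"
proof -
  have "f - f * f = f * (1 - f)" by (simp add: algebra_simps)
  then show ?thesis
    using assms by (simp add: norm_poly_op_square[OF symmetric] poly_op_mono poly_cone_mult)
qed

lemma norm_poly_op_le:
  assumes "1 - f * f \<in> poly_cone t"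
  shows "norm (poly_op A f x) \<le> norm x"
proof -
  have "(norm (poly_op A f x))\<^sup>2 \<le> (norm x)\<^sup>2"
    using poly_op_mono[OF assms, of x]
    by (simp add: norm_poly_op_square[OF symmetric] dot_square_norm)
  then show ?thesis by simp
qed

abbreviation sqrt_approx :: "nat \<Rightarrow> 'a \<Rightarrow> 'a" where
  "sqrt_approx n \<equiv> poly_op A (t * sqrt_quot t n)"

lemma norm_sqrt_approx_le: "norm (sqrt_approx n x) \<le> norm x"
proof (rule norm_poly_op_le)
  let ?p = "t * sqrt_quot t n"
  have "1 - ?p * ?p = (1 - ?p) + ?p * (1 - ?p)" by (simp add: algebra_simps)
  moreover have "\<dots> \<in> poly_cone t"
    using sqrt_quot_cone[of t n] by (auto intro!: poly_cone_add poly_cone_mult poly_cone_base)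
  ultimately show "1 - ?p * ?p \<in> poly_cone t" by (simp only:)
qed

text \<open>The quadratic forms increase and are bounded by the squared norm of \<open>x\<close>,
  hence converge; \<open>norm_poly_op_square_le\<close> for the differences of approximants turns
  this into the Cauchy property of the vectors.\<close>

lemma Cauchy_sqrt_approx: "Cauchy (\<lambda>n. sqrt_approx n x)"
proof -
  let ?p = "\<lambda>n. t * sqrt_quot t n"
  let ?r = "\<lambda>n. x \<bullet> sqrt_approx n x"
  have step: "(norm (sqrt_approx n x - sqrt_approx m x))\<^sup>2 \<le> ?r n - ?r m" if "m \<le> n" for m n
  proof -
    have "1 - (?p n - ?p m) = (1 - ?p n) + ?p m" by simp
    moreover have "\<dots> \<in> poly_cone t"
      using sqrt_quot_cone[of t n] sqrt_quot_cone[of t m]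
      by (intro poly_cone_add poly_cone_mult poly_cone_base) auto
    ultimately have "1 - (?p n - ?p m) \<in> poly_cone t" by (simp only:)
    from norm_poly_op_square_le[OF sqrt_quot_diff_cone[OF that] this, of x] show ?thesis
      by (simp add: poly_op_diff inner_diff_right)
  qed
  have "incseq ?r"
  proof (rule incseq_SucI)
    fix n show "?r n \<le> ?r (Suc n)"
      using order_trans[OF zero_le_power2 step[of n "Suc n"]] by simp
  qed
  moreover have "?r n \<le> x \<bullet> x" for n
    using poly_op_mono[of 1 "?p n" x] sqrt_quot_cone[of t n] by simp
  ultimately obtain L where "?r \<longlonglongrightarrow> L"
    using incseq_convergent by blast
  then have C: "Cauchy ?r" by (rule LIMSEQ_imp_Cauchy)
  show ?thesis
  proof (rule metric_CauchyI)
    fix e :: real assume "0 < e"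
    then obtain M where M: "\<And>m n. m \<ge> M \<Longrightarrow> n \<ge> M \<Longrightarrow> norm (?r m - ?r n) < e\<^sup>2"
      using CauchyD[OF C, of "e\<^sup>2"] by auto
    have less: "dist (sqrt_approx m x) (sqrt_approx n x) < e" if "M \<le> m" "m \<le> n" for m n
    proof -
      from that have "(norm (sqrt_approx n x - sqrt_approx m x))\<^sup>2 < e\<^sup>2"
        using step[of m n] M[of n m] by auto
      then show ?thesis
        using \<open>0 < e\<close> by (simp add: dist_norm norm_minus_commute power_less_imp_less_base)
    qed
    show "\<exists>M. \<forall>m\<ge>M. \<forall>n\<ge>M. dist (sqrt_approx m x) (sqrt_approx n x) < e"
      using less by (metis dist_commute nle_le)
  qed
qed

definition sqrt_op :: "'a \<Rightarrow> 'a" where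
  "sqrt_op x = lim (\<lambda>n. sqrt_approx n x)"

lemma sqrt_approx_tendsto: "(\<lambda>n. sqrt_approx n x) \<longlonglongrightarrow> sqrt_op x"
  unfolding sqrt_op_def
  by (rule convergent_LIMSEQ_iff[THEN iffD1]) (rule Cauchy_convergent[OF Cauchy_sqrt_approx])

lemma bounded_linear_poly: "bounded_linear (poly_op A p)"
  by (rule bounded_linear_poly_op[OF symmetric_op_bounded_linear[OF symmetric]])

lemma bounded_linear_sqrt_op: "bounded_linear sqrt_op"
proof (rule bounded_linear_intro[where K = 1])
  fix x y :: 'a and r :: real
  have "(\<lambda>n. sqrt_approx n (x + y)) \<longlonglongrightarrow> sqrt_op x + sqrt_op y"
    using tendsto_add[OF sqrt_approx_tendsto[of x] sqrt_approx_tendsto[of y]]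
    by (simp add: linear_add[OF bounded_linear.linear[OF bounded_linear_poly]])
  then show "sqrt_op (x + y) = sqrt_op x + sqrt_op y"
    by (rule LIMSEQ_unique[OF sqrt_approx_tendsto])
  have "(\<lambda>n. sqrt_approx n (r *\<^sub>R x)) \<longlonglongrightarrow> r *\<^sub>R sqrt_op x"
    using tendsto_scaleR[OF tendsto_const[of r] sqrt_approx_tendsto[of x]]
    by (simp add: linear_scale[OF bounded_linear.linear[OF bounded_linear_poly]])
  then show "sqrt_op (r *\<^sub>R x) = r *\<^sub>R sqrt_op x"
    by (rule LIMSEQ_unique[OF sqrt_approx_tendsto])
  show "norm (sqrt_op x) \<le> norm x * 1"
    using tendsto_norm[OF sqrt_approx_tendsto[of x]]
    by (rule LIMSEQ_le_const2) (simp add: norm_sqrt_approx_le)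
qed

lemma psd_sqrt_op: "psd sqrt_op"
proof -
  have "sqrt_op x \<bullet> y = x \<bullet> sqrt_op y" for x y
  proof (rule LIMSEQ_unique)
    show "(\<lambda>n. sqrt_approx n x \<bullet> y) \<longlonglongrightarrow> sqrt_op x \<bullet> y"
      by (intro tendsto_intros sqrt_approx_tendsto)
    show "(\<lambda>n. sqrt_approx n x \<bullet> y) \<longlonglongrightarrow> x \<bullet> sqrt_op y"
      unfolding symmetric_opD[OF symmetric_op_poly_op[OF symmetric]]
      by (intro tendsto_intros sqrt_approx_tendsto)
  qed
  moreover have "0 \<le> x \<bullet> sqrt_op x" for x
  proof (rule LIMSEQ_le_const)
    show "(\<lambda>n. x \<bullet> sqrt_approx n x) \<longlonglongrightarrow> x \<bullet> sqrt_op x"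
      by (intro tendsto_intros sqrt_approx_tendsto)
    show "\<exists>N. \<forall>n\<ge>N. 0 \<le> x \<bullet> sqrt_approx n x"
      using sqrt_quot_cone by (auto intro!: poly_op_nonneg poly_cone_mult poly_cone_base)
  qed
  ultimately show ?thesis
    by (simp add: psd_def symmetric_op_def bounded_linear_sqrt_op)
qed

text \<open>The polynomial is t - p_n^2, which is twice the increment of a convergent
  sequence.\<close>

lemma residual_tendsto_0:
  "(\<lambda>n. poly_op A (t * (1 - t * (sqrt_quot t n)\<^sup>2)) x) \<longlonglongrightarrow> 0"
proof -
  have "poly_op A (t * (1 - t * (sqrt_quot t n)\<^sup>2)) x =
      2 *\<^sub>R (sqrt_approx (Suc n) x - sqrt_approx n x)" for n
    by (simp add: distrib_left poly_op_add poly_op_smult)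
  moreover have "(\<lambda>n. 2 *\<^sub>R (sqrt_approx (Suc n) x - sqrt_approx n x)) \<longlonglongrightarrow>
      2 *\<^sub>R (sqrt_op x - sqrt_op x)"
    by (intro tendsto_intros LIMSEQ_Suc sqrt_approx_tendsto)
  ultimately show ?thesis by simp
qed

lemma sqrt_op_square: "sqrt_op (sqrt_op x) = poly_op A t x"
proof -
  let ?z = "\<lambda>n. poly_op A (t * (1 - t * (sqrt_quot t n)\<^sup>2)) x"
  \<comment> \<open>The operator and its argument both vary with \<open>n\<close>; uniform
    contractivity makes the error vanish.\<close>
  have "(\<lambda>n. sqrt_approx n (sqrt_op x - sqrt_approx n x)) \<longlonglongrightarrow> 0"
  proof (rule Lim_null_comparison)
    show "(\<lambda>n. norm (sqrt_op x - sqrt_approx n x)) \<longlonglongrightarrow> 0"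
      using tendsto_diff[OF tendsto_const[of "sqrt_op x"] sqrt_approx_tendsto[of x]]
      by (intro tendsto_norm_zero) simp
  qed (simp add: norm_sqrt_approx_le)
  then have "(\<lambda>n. sqrt_approx n (sqrt_op x) -
      sqrt_approx n (sqrt_op x - sqrt_approx n x) + ?z n) \<longlonglongrightarrow> sqrt_op (sqrt_op x) - 0 + 0"
    by (intro tendsto_intros sqrt_approx_tendsto residual_tendsto_0)
  \<comment> \<open>The first two terms combine to p_n^2 applied to \<open>x\<close>, and adding the
    residual t - p_n^2 makes the sequence constant.\<close>
  moreover have "sqrt_approx n (sqrt_op x) - sqrt_approx n (sqrt_op x - sqrt_approx n x) + ?z n =
      poly_op A t x" for n
  proof -
    let ?p = "t * sqrt_quot t n"
    have "t = ?p * ?p + t * (1 - t * (sqrt_quot t n)\<^sup>2)"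
      by (simp add: algebra_simps power2_eq_square)
    then have "poly_op A t x = poly_op A (?p * ?p + t * (1 - t * (sqrt_quot t n)\<^sup>2)) x"
      by (rule arg_cong)
    then have "poly_op A t x = sqrt_approx n (sqrt_approx n x) + ?z n"
      unfolding poly_op_add poly_op_mult[OF symmetric_op_linear[OF symmetric], of ?p ?p] .
    then show ?thesis
      by (simp add: linear_diff[OF bounded_linear.linear[OF bounded_linear_poly]])
  qed
  ultimately show ?thesis
    by (simp add: LIMSEQ_const_iff)
qed

lemma sqrt_op_commute:
  assumes "bounded_linear C" "\<And>x. C (A x) = A (C x)"
  shows "C (sqrt_op x) = sqrt_op (C x)"
proof (rule LIMSEQ_unique)
  show "(\<lambda>n. C (sqrt_approx n x)) \<longlonglongrightarrow> C (sqrt_op x)"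
    by (rule bounded_linear.tendsto[OF assms(1) sqrt_approx_tendsto])
  show "(\<lambda>n. C (sqrt_approx n x)) \<longlonglongrightarrow> sqrt_op (C x)"
    using sqrt_approx_tendsto[of "C x"]
    by (simp add: poly_op_commute symmetric_op_linear symmetric bounded_linear.linear assms)
qed

end

section \<open>Existence and uniqueness of positive square roots\<close>

lemma symmetric_op_scaleR:
  assumes "symmetric_op A"
  shows "symmetric_op (\<lambda>x. c *\<^sub>R A x)"
  using assms bounded_linear_compose[OF bounded_linear_scaleR_right, of A c]
  by (simp add: symmetric_op_def)

lemma psd_scaleR: "psd A \<Longrightarrow> 0 \<le> c \<Longrightarrow> psd (\<lambda>x. c *\<^sub>R A x)"
  by (simp add: psd_def symmetric_op_scaleR)

lemma symmetric_op_scaleR_contraction: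
  assumes "symmetric_op A"
  shows "\<exists>c>0. \<forall>x. norm ((1 / c) *\<^sub>R A x) \<le> norm x"
proof -
  obtain c where c: "0 < c" "\<And>x. norm (A x) \<le> norm x * c"
    using bounded_linear.pos_bounded[OF symmetric_op_bounded_linear[OF assms]] by blast
  then have "norm ((1 / c) *\<^sub>R A x) \<le> norm x" for x
    by (simp add: field_simps)
  with c(1) show ?thesis by blast
qed

text \<open>Scaling to norm at most 1 reduces to the locale with t = X. The commutation clause holds
  because the root is a limit of polynomials in \<open>R\<close>; uniqueness and complex linearity
  of roots rest on it.\<close>

lemma psd_sqrt_exists:
  fixes R :: "'a :: {real_inner, complete_space} \<Rightarrow> 'a"
  assumes "psd R"
  shows "\<exists>M. psd M \<and> (\<forall>x. M (M x) = R x) \<and>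
    (\<forall>C. bounded_linear C \<longrightarrow> (\<forall>x. C (R x) = R (C x)) \<longrightarrow> (\<forall>x. C (M x) = M (C x)))"
proof -
  note sym = psd_symmetric_op[OF assms]
  obtain c where c: "0 < c" "\<And>x. norm ((1 / c) *\<^sub>R R x) \<le> norm x"
    using symmetric_op_scaleR_contraction[OF sym] by blast
  let ?A = "\<lambda>x. (1 / c) *\<^sub>R R x"
  have symA: "symmetric_op ?A" by (rule symmetric_op_scaleR[OF sym])
  interpret unit_interval_op ?A "[:0, 1:]"
  proof
    show "symmetric_op ?A" by (rule symA)
    fix x
    show "0 \<le> x \<bullet> poly_op ?A [:0, 1:] x"
      using assms c(1) by (simp add: poly_op_X symmetric_op_linear[OF symA] psd_nonneg)
    have "x \<bullet> ?A x \<le> norm x * norm (?A x)" by (rule norm_cauchy_schwarz)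
    also have "\<dots> \<le> norm x * norm x" by (intro mult_left_mono c) simp
    finally show "0 \<le> x \<bullet> poly_op ?A (1 - [:0, 1:]) x"
      by (simp add: poly_op_diff poly_op_X symmetric_op_linear[OF symA] inner_diff_right
          dot_square_norm power2_eq_square)
  qed
  let ?M = "\<lambda>x. sqrt c *\<^sub>R sqrt_op x"
  show ?thesis
  proof (intro exI[of _ ?M] conjI allI impI)
    show "psd ?M" using c(1) by (intro psd_scaleR psd_sqrt_op) simp
    note lin = bounded_linear.linear[OF bounded_linear_sqrt_op]
    show "?M (?M x) = R x" for x
      using c(1) by (simp add: linear_scale[OF lin] sqrt_op_square poly_op_X symmetric_op_linear[OF symA])
    show "C (?M x) = ?M (C x)" if C: "bounded_linear C" "\<forall>x. C (R x) = R (C x)" for C x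
    proof -
      note linC = linear_scale[OF bounded_linear.linear[OF C(1)]]
      have "C (sqrt_op x) = sqrt_op (C x)"
        by (rule sqrt_op_commute[OF C(1)]) (simp add: linC C(2))
      then show ?thesis by (simp add: linC)
    qed
  qed
qed

text \<open>For a root \<open>N\<close> of \<open>P\<close> the form is the squared norm of
  \<open>N x\<close>, so \<open>N x\<close> and then \<open>N (N x)\<close> vanish.\<close>

lemma psd_inner_eq_0:
  fixes P :: "'a :: {real_inner, complete_space} \<Rightarrow> 'a"
  assumes "psd P" "x \<bullet> P x = 0"
  shows "P x = 0"
proof -
  obtain N where N: "psd N" "\<And>x. N (N x) = P x"
    using psd_sqrt_exists[OF assms(1)] by blast
  have "N x \<bullet> N x = x \<bullet> P x"
    by (simp add: symmetric_opD[OF psd_symmetric_op[OF N(1)]] N(2))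
  then have "N x = 0" using assms(2) by simp
  then show ?thesis
    using N(2)[of x] linear_0[OF symmetric_op_linear[OF psd_symmetric_op[OF N(1)]]] by simp
qed

text \<open>The vector y = (P - Q) x satisfies (P + Q) y = 0, so both nonnegative forms vanish at y.
  Then P y = Q y = 0, and the squared norm of y equals <x, P y - Q y> = 0.\<close>

lemma psd_sqrt_unique_commuting:
  fixes P Q :: "'a :: {real_inner, complete_space} \<Rightarrow> 'a"
  assumes P: "psd P" and Q: "psd Q" and eq: "\<And>x. P (P x) = Q (Q x)"
    and comm: "\<And>x. P (Q x) = Q (P x)"
  shows "P = Q"
proof
  fix x
  note lin = symmetric_op_linear[OF psd_symmetric_op[OF P]] symmetric_op_linear[OF psd_symmetric_op[OF Q]]
  define y where "y = P x - Q x"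
  have "P y + Q y = 0"
    by (simp add: y_def linear_diff[OF lin(1)] linear_diff[OF lin(2)] eq comm)
  then have "y \<bullet> P y + y \<bullet> Q y = 0"
    by (metis inner_add_right inner_zero_right)
  then have "y \<bullet> P y = 0" "y \<bullet> Q y = 0"
    using psd_nonneg[OF P, of y] psd_nonneg[OF Q, of y] by linarith+
  then have "P y = 0" "Q y = 0"
    using psd_inner_eq_0[OF P] psd_inner_eq_0[OF Q] by simp_all
  moreover have "y \<bullet> y = x \<bullet> P y - x \<bullet> Q y"
    by (subst (1) y_def)
      (simp add: inner_diff_left symmetric_opD[OF psd_symmetric_op[OF P]] symmetric_opD[OF psd_symmetric_op[OF Q]])
  ultimately show "P x = Q x" by (simp add: y_def)
qed

text \<open>The constructed root \<open>M\<close> of the common square commutes with both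
  \<open>P\<close> and \<open>Q\<close>, so each equals \<open>M\<close> by the commuting
  case.\<close>

lemma psd_sqrt_unique:
  fixes P Q :: "'a :: {real_inner, complete_space} \<Rightarrow> 'a"
  assumes "psd P" "psd Q" "\<And>x. P (P x) = Q (Q x)"
  shows "P = Q"
proof -
  have "psd (\<lambda>x. P (P x))"
    using assms(1) bounded_linear_compose[of P P]
    by (simp add: psd_def symmetric_op_def) (metis inner_ge_zero)
  then obtain M where M: "psd M" "\<And>x. M (M x) = P (P x)"
    "\<forall>C. bounded_linear C \<longrightarrow> (\<forall>x. C (P (P x)) = P (P (C x))) \<longrightarrow> (\<forall>x. C (M x) = M (C x))"
    using psd_sqrt_exists[of "\<lambda>x. P (P x)"] by blast
  have "P = M"
  proof (rule psd_sqrt_unique_commuting)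
    show "P (M x) = M (P x)" for x
      using assms by (intro M(3)[rule_format] symmetric_op_bounded_linear psd_symmetric_op) simp_all
  qed (use assms M in auto)
  moreover have "Q = M"
  proof (rule psd_sqrt_unique_commuting)
    show "Q (M x) = M (Q x)" for x
      using assms by (intro M(3)[rule_format] symmetric_op_bounded_linear psd_symmetric_op) simp_all
  qed (use assms M in auto)
  ultimately show ?thesis by simp
qed

section \<open>Approximate signs and the modulus\<close>

text \<open>For B = A/c and t = X^2, the polynomial s_n = X q_n takes the value p_n(b^2)/b at b
  \<noteq> 0, which tends to the sign of b. Uniqueness of roots identifies \<open>D\<close> with c
  times the constructed root, and polynomials in B inherit all commutation from
  \<open>A\<close>.\<close>

lemma sign_approximation:
  fixes A D :: "'a :: {real_inner, complete_space} \<Rightarrow> 'a"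
  assumes A: "symmetric_op A" and D: "psd D" and sq: "\<And>x. D (D x) = A (A x)"
  shows "\<exists>S. (\<forall>n. symmetric_op (S n)) \<and> (\<forall>n x. norm (S n x) \<le> norm x) \<and>
    (\<forall>x. (\<lambda>n. S n (A x)) \<longlonglongrightarrow> D x) \<and> (\<forall>x. (\<lambda>n. S n (D x)) \<longlonglongrightarrow> A x) \<and>
    (\<forall>n C. linear C \<longrightarrow> (\<forall>x. C (A x) = A (C x)) \<longrightarrow> (\<forall>x. C (S n x) = S n (C x)))"
proof -
  obtain c where c: "0 < c" "\<And>x. norm ((1 / c) *\<^sub>R A x) \<le> norm x"
    using symmetric_op_scaleR_contraction[OF A] by blast
  define B where "B = (\<lambda>x. (1 / c) *\<^sub>R A x)"
  have B: "symmetric_op B" unfolding B_def by (rule symmetric_op_scaleR[OF A])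
  note linB = symmetric_op_linear[OF B]
  define X where "X = ([:0, 1:] :: real poly)"
  define t where "t = X * X"
  have opX: "poly_op B X x = B x" for x by (simp add: X_def poly_op_X linB)
  have opt: "poly_op B t x = B (B x)" for x by (simp add: t_def poly_op_mult linB opX)
  interpret unit_interval_op B t
  proof
    show "symmetric_op B" by (rule B)
    fix x
    have *: "x \<bullet> poly_op B t x = (norm (B x))\<^sup>2"
      by (simp add: opt power2_norm_eq_inner symmetric_opD[OF B])
    show "0 \<le> x \<bullet> poly_op B t x" by (simp add: *)
    have "(norm (B x))\<^sup>2 \<le> (norm x)\<^sup>2"
      using c(2)[of x] by (intro power_mono) (simp_all add: B_def)
    then show "0 \<le> x \<bullet> poly_op B (1 - t) x"
      by (simp add: poly_op_diff inner_diff_right * dot_square_norm)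
  qed
  have D_eq: "D = (\<lambda>x. c *\<^sub>R sqrt_op x)"
  proof (rule psd_sqrt_unique[OF D])
    show "psd (\<lambda>x. c *\<^sub>R sqrt_op x)" using c(1) by (intro psd_scaleR psd_sqrt_op) simp
    fix x
    have "c *\<^sub>R sqrt_op (c *\<^sub>R sqrt_op x) = (c * c) *\<^sub>R B (B x)"
      by (simp add: linear_scale[OF bounded_linear.linear[OF bounded_linear_sqrt_op]]
          sqrt_op_square opt)
    also have "\<dots> = D (D x)"
      using c(1) by (simp add: sq B_def linear_scale[OF symmetric_op_linear[OF A]])
    finally show "D (D x) = c *\<^sub>R sqrt_op (c *\<^sub>R sqrt_op x)" by simp
  qed
  define s where "s n = X * sqrt_quot t n" for n
  define S where "S n = poly_op B (s n)" for n
  have A_eq: "A x = c *\<^sub>R B x" for x using c(1) by (simp add: B_def)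
  have linS: "linear (S n)" for n
    unfolding S_def by (rule bounded_linear.linear[OF bounded_linear_poly])
  have ss: "1 - s n * s n = 1 - t * (sqrt_quot t n)\<^sup>2" for n
    by (simp add: s_def t_def power2_eq_square)
  have contr: "norm (S n x) \<le> norm x" for n x
    unfolding S_def by (rule norm_poly_op_le) (use sqrt_quot_cone[of t n] in \<open>simp add: ss\<close>)
  have SB: "S n (B x) = sqrt_approx n x" for n x
  proof -
    have "t * sqrt_quot t n = s n * X" by (simp add: s_def t_def)
    then show ?thesis by (simp add: S_def poly_op_mult linB opX)
  qed
  \<comment> \<open>Here X = s_n p_n + X Z_n. The remainder vanishes since the squared norm of X Z_n
    at \<open>x\<close> is <x, t Z_n^2 x> <= <x, t Z_n x>, and t Z_n is the residual.\<close>
  have lim_D: "(\<lambda>n. S n (sqrt_op x)) \<longlonglongrightarrow> B x" for x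
  proof -
    let ?Z = "\<lambda>n. 1 - t * (sqrt_quot t n)\<^sup>2"
    have "(\<lambda>n. S n (sqrt_op x - sqrt_approx n x)) \<longlonglongrightarrow> 0"
    proof (rule Lim_null_comparison)
      show "(\<lambda>n. norm (sqrt_op x - sqrt_approx n x)) \<longlonglongrightarrow> 0"
        using tendsto_diff[OF tendsto_const[of "sqrt_op x"] sqrt_approx_tendsto[of x]]
        by (intro tendsto_norm_zero) simp
    qed (simp add: contr)
    moreover have "(\<lambda>n. poly_op B (X * ?Z n) x) \<longlonglongrightarrow> 0"
    proof -
      have "(\<lambda>n. (norm (poly_op B (X * ?Z n) x))\<^sup>2) \<longlonglongrightarrow> 0"
      proof (rule Lim_null_comparison)
        show "(\<lambda>n. x \<bullet> poly_op B (t * ?Z n) x) \<longlonglongrightarrow> 0"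
          using tendsto_inner[OF tendsto_const[of x] residual_tendsto_0[of x]] by simp
        show "\<forall>\<^sub>F n in sequentially. norm ((norm (poly_op B (X * ?Z n) x))\<^sup>2) \<le> x \<bullet> poly_op B (t * ?Z n) x"
        proof (rule always_eventually, rule allI)
          fix n
          \<comment> \<open>This is t Z (1 - Z) with 1 - Z = t q^2.\<close>
          have "t * ?Z n - X * ?Z n * (X * ?Z n) = t * (?Z n * (t * (sqrt_quot t n * sqrt_quot t n)))"
            by (simp add: t_def power2_eq_square algebra_simps)
          moreover have "\<dots> \<in> poly_cone t"
            using sqrt_quot_cone[of t n] by (intro poly_cone_mult poly_cone_base) auto
          ultimately have "(norm (poly_op B (X * ?Z n) x))\<^sup>2 \<le> x \<bullet> poly_op B (t * ?Z n) x"
            unfolding norm_poly_op_square[OF symmetric] by (intro poly_op_mono) simp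
          then show "norm ((norm (poly_op B (X * ?Z n) x))\<^sup>2) \<le> x \<bullet> poly_op B (t * ?Z n) x"
            by simp
        qed
      qed
      then have "(\<lambda>n. norm (poly_op B (X * ?Z n) x)) \<longlonglongrightarrow> 0"
        by simp
      then show ?thesis by (rule tendsto_norm_zero_cancel)
    qed
    ultimately have "(\<lambda>n. B x + S n (sqrt_op x - sqrt_approx n x) - poly_op B (X * ?Z n) x)
        \<longlonglongrightarrow> B x + 0 - 0"
      by (intro tendsto_intros)
    moreover have "B x + S n (sqrt_op x - sqrt_approx n x) - poly_op B (X * ?Z n) x = S n (sqrt_op x)" for n
    proof -
      have "X = s n * (t * sqrt_quot t n) + X * ?Z n"
        by (simp add: s_def power2_eq_square algebra_simps)
      then have "poly_op B X x = poly_op B (s n * (t * sqrt_quot t n) + X * ?Z n) x"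
        by (rule arg_cong)
      then have "B x = S n (sqrt_approx n x) + poly_op B (X * ?Z n) x"
        unfolding S_def opX poly_op_add poly_op_mult[OF linB, of "s n" "t * sqrt_quot t n"] .
      then show ?thesis by (simp add: linear_diff[OF linS])
    qed
    ultimately show ?thesis by simp
  qed
  show ?thesis
  proof (intro exI[of _ S] conjI allI impI)
    show "symmetric_op (S n)" for n unfolding S_def by (rule symmetric_op_poly_op[OF B])
    show "norm (S n x) \<le> norm x" for n x by (rule contr)
    show "(\<lambda>n. S n (A x)) \<longlonglongrightarrow> D x" for x
      using tendsto_scaleR[OF tendsto_const[of c] sqrt_approx_tendsto[of x]]
      by (simp add: A_eq D_eq linear_scale[OF linS] SB)
    show "(\<lambda>n. S n (D x)) \<longlonglongrightarrow> A x" for x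
      using tendsto_scaleR[OF tendsto_const[of c] lim_D[of x]]
      by (simp add: A_eq D_eq linear_scale[OF linS])
    show "C (S n x) = S n (C x)" if "linear C" "\<forall>x. C (A x) = A (C x)" for n C x
      unfolding S_def using that linB
      by (intro poly_op_commute) (simp_all add: B_def linear_scale)
  qed
qed

text \<open>The form of \<open>A\<close> is the limit of <x, S_n D x>. With a root \<open>E\<close>
  of \<open>D\<close> commuting with \<open>S n\<close>, this is <E x, S_n E x>, bounded by the
  squared norm of \<open>E x\<close>, which is <x, D x>.\<close>

lemma abs_inner_le_modulus:
  fixes A D :: "'a :: {real_inner, complete_space} \<Rightarrow> 'a"
  assumes A: "symmetric_op A" and D: "psd D" and sq: "\<And>x. D (D x) = A (A x)"
  shows "\<bar>x \<bullet> A x\<bar> \<le> x \<bullet> D x"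
proof -
  obtain S where S: "\<And>n. symmetric_op (S n)" "\<And>n x. norm (S n x) \<le> norm x"
    "\<And>x. (\<lambda>n. S n (A x)) \<longlonglongrightarrow> D x" "\<And>x. (\<lambda>n. S n (D x)) \<longlonglongrightarrow> A x"
    "\<forall>n C. linear C \<longrightarrow> (\<forall>x. C (A x) = A (C x)) \<longrightarrow> (\<forall>x. C (S n x) = S n (C x))"
    using sign_approximation[OF A D sq] by blast
  obtain E where E: "psd E" "\<And>x. E (E x) = D x"
    "\<forall>C. bounded_linear C \<longrightarrow> (\<forall>x. C (D x) = D (C x)) \<longrightarrow> (\<forall>x. C (E x) = E (C x))"
    using psd_sqrt_exists[OF D] by blast
  \<comment> \<open>\<open>D\<close> is the strong limit of \<open>S m\<close> composed with
    \<open>A\<close>, and \<open>S n\<close> commutes with both factors.\<close>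
  have "S n (D x) = D (S n x)" for n x
  proof -
    have "S n (S m (A x)) = S m (A (S n x))" for m
    proof -
      note linA = symmetric_op_linear[OF A]
      have SA: "A (S k y) = S k (A y)" for k y
        by (rule S(5)[rule_format, OF linA]) simp
      have "S n (S m (A x)) = S m (S n (A x))"
        by (rule S(5)[rule_format, OF symmetric_op_linear[OF S(1)]]) (simp add: SA)
      then show ?thesis by (simp add: SA)
    qed
    moreover have "(\<lambda>m. S n (S m (A x))) \<longlonglongrightarrow> S n (D x)"
      by (rule bounded_linear.tendsto[OF symmetric_op_bounded_linear[OF S(1)] S(3)])
    ultimately have "(\<lambda>m. S m (A (S n x))) \<longlonglongrightarrow> S n (D x)" by simp
    then show ?thesis by (rule LIMSEQ_unique) (rule S(3))
  qed
  then have SE: "S n (E x) = E (S n x)" for n x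
    by (intro E(3)[rule_format] symmetric_op_bounded_linear S(1)) simp
  have "\<bar>x \<bullet> S n (D x)\<bar> \<le> x \<bullet> D x" for n
  proof -
    have "x \<bullet> S n (D x) = E x \<bullet> S n (E x)"
      by (simp add: symmetric_opD[OF psd_symmetric_op[OF E(1)]] SE flip: E(2))
    also have "\<bar>\<dots>\<bar> \<le> norm (E x) * norm (S n (E x))" by (rule Cauchy_Schwarz_ineq2)
    also have "\<dots> \<le> norm (E x) * norm (E x)" by (intro mult_left_mono S(2)) simp
    also have "\<dots> = x \<bullet> D x"
      by (simp add: symmetric_opD[OF psd_symmetric_op[OF E(1)]] E(2) flip: norm_eq_square dot_square_norm power2_eq_square)
    finally show ?thesis .
  qed
  moreover have "(\<lambda>n. \<bar>x \<bullet> S n (D x)\<bar>) \<longlonglongrightarrow> \<bar>x \<bullet> A x\<bar>"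
    by (intro tendsto_intros S(4))
  ultimately show ?thesis by (intro LIMSEQ_le_const2) auto
qed

text \<open>Polarization: 4 <x, A y> is the form of \<open>A\<close> at x + y minus that at x - y.
  Bounding both by \<open>R\<close> and using the parallelogram law gives the claim.\<close>

lemma inner_le_of_abs_inner_le:
  assumes A: "symmetric_op A" and R: "symmetric_op R" and le: "\<And>x. \<bar>x \<bullet> A x\<bar> \<le> x \<bullet> R x"
  shows "x \<bullet> A y \<le> (x \<bullet> R x + y \<bullet> R y) / 2"
proof -
  note lin = symmetric_op_linear[OF A] symmetric_op_linear[OF R]
  have comm: "y \<bullet> A x = x \<bullet> A y" "y \<bullet> R x = x \<bullet> R y"
    using symmetric_opD[OF A] symmetric_opD[OF R] by (metis inner_commute)+
  show ?thesis
    using le[of "x + y"] le[of "x - y"]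
    by (simp add: linear_add[OF lin(1)] linear_add[OF lin(2)] linear_diff[OF lin(1)]
        linear_diff[OF lin(2)] inner_add_left inner_add_right inner_diff_left inner_diff_right comm)
qed


section \<open>The trace norm on square-summable families\<close>

lemma infsum_ennreal:
  fixes f :: "'a \<Rightarrow> real"
  assumes "f summable_on A" "\<And>x. x \<in> A \<Longrightarrow> 0 \<le> f x"
  shows "ennreal (infsum f A) = (\<Sum>\<^sub>\<infinity>x\<in>A. ennreal (f x))"
proof -
  have "infsum (ennreal \<circ> f) A = ennreal (infsum f A)"
    by (rule infsum_comm_additive_general) (auto simp: assms subset_iff intro!: sum_ennreal)
  then show ?thesis by (simp add: o_def)
qed

lemma ennreal_summable_on:
  fixes f :: "'a \<Rightarrow> ennreal"
  shows "f summable_on A"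
  by (rule nonneg_summable_on_complete) simp

lemma sum_le_infsum_ennreal:
  fixes f :: "'a \<Rightarrow> ennreal"
  assumes "finite F"
  shows "sum f F \<le> (\<Sum>\<^sub>\<infinity>x. f x)"
  by (subst nonneg_infsum_complete) (auto intro!: SUP_upper assms)

lemma infsum_sum_ennreal:
  fixes f :: "'a \<Rightarrow> 'b \<Rightarrow> ennreal"
  assumes "finite F"
  shows "(\<Sum>i\<in>F. \<Sum>\<^sub>\<infinity>j. f i j) = (\<Sum>\<^sub>\<infinity>j. \<Sum>i\<in>F. f i j)"
  using assms by induction (simp_all add: infsum_add ennreal_summable_on)

text \<open>One inequality, proved for arbitrary index types, suffices by symmetry; it follows by
  exchanging finite outer sums.\<close>

lemma infsum_swap_ennreal:
  fixes f :: "'a \<Rightarrow> 'b \<Rightarrow> ennreal"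
  shows "(\<Sum>\<^sub>\<infinity>i. \<Sum>\<^sub>\<infinity>j. f i j) = (\<Sum>\<^sub>\<infinity>j. \<Sum>\<^sub>\<infinity>i. f i j)"
proof -
  have le: "(\<Sum>\<^sub>\<infinity>i. \<Sum>\<^sub>\<infinity>j. g i j) \<le> (\<Sum>\<^sub>\<infinity>j. \<Sum>\<^sub>\<infinity>i. g i j)"
    for g :: "'c \<Rightarrow> 'd \<Rightarrow> ennreal"
  proof (rule infsum_le_finite_sums)
    fix F :: "'c set" assume F: "finite F"
    have "(\<Sum>i\<in>F. \<Sum>\<^sub>\<infinity>j. g i j) = (\<Sum>\<^sub>\<infinity>j. \<Sum>i\<in>F. g i j)"
      by (rule infsum_sum_ennreal[OF F])
    also have "\<dots> \<le> (\<Sum>\<^sub>\<infinity>j. \<Sum>\<^sub>\<infinity>i. g i j)"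
      by (intro infsum_mono sum_le_infsum_ennreal F ennreal_summable_on)
    finally show "(\<Sum>i\<in>F. \<Sum>\<^sub>\<infinity>j. g i j) \<le> (\<Sum>\<^sub>\<infinity>j. \<Sum>\<^sub>\<infinity>i. g i j)" .
  qed (rule ennreal_summable_on)
  show ?thesis by (rule antisym) (rule le)+
qed

text \<open>The inequality \<open>le\<close> for the factor 1/c gives the reverse inequality for
  c.\<close>

lemma infsum_cmult_ennreal:
  fixes f :: "'a \<Rightarrow> ennreal"
  assumes "0 \<le> c"
  shows "(\<Sum>\<^sub>\<infinity>i. ennreal c * f i) = ennreal c * (\<Sum>\<^sub>\<infinity>i. f i)"
proof (cases "c = 0")
  case False
  have le: "(\<Sum>\<^sub>\<infinity>i. ennreal d * g i) \<le> ennreal d * (\<Sum>\<^sub>\<infinity>i. g i)" for d and g :: "'a \<Rightarrow> ennreal"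
    by (rule infsum_le_finite_sums[OF ennreal_summable_on])
      (auto simp flip: sum_distrib_left intro!: mult_left_mono sum_le_infsum_ennreal)
  have inv: "ennreal (1 / c) * (ennreal c * x) = x" "ennreal c * (ennreal (1 / c) * x) = x" for x
    using assms False by (simp_all flip: mult.assoc ennreal_mult)
  have "ennreal c * (\<Sum>\<^sub>\<infinity>i. f i) = ennreal c * (\<Sum>\<^sub>\<infinity>i. ennreal (1 / c) * (ennreal c * f i))"
    by (simp add: inv)
  also have "\<dots> \<le> ennreal c * (ennreal (1 / c) * (\<Sum>\<^sub>\<infinity>i. ennreal c * f i))"
    by (intro mult_left_mono le) simp
  also have "\<dots> = (\<Sum>\<^sub>\<infinity>i. ennreal c * f i)"
    by (rule inv)
  finally show ?thesis by (intro antisym le)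
qed simp

section \<open>Norm and completeness of the sequence space\<close>

lemma summable_cmod_Rep_ell2: "(\<lambda>i. (cmod (Rep_ell2 \<psi> i))\<^sup>2) summable_on UNIV"
  using Rep_ell2[of \<psi>] by (simp add: square_summable_def)

lemma norm_ell2_square: "(norm \<psi>)\<^sup>2 = (\<Sum>\<^sub>\<infinity>i. (cmod (Rep_ell2 \<psi> i))\<^sup>2)"
  by (simp add: power2_norm_eq_inner inner_ell2_def cinner_self)

lemma ennreal_norm_ell2_square:
  "ennreal ((norm \<psi>)\<^sup>2) = (\<Sum>\<^sub>\<infinity>i. ennreal ((cmod (Rep_ell2 \<psi> i))\<^sup>2))"
  by (simp add: norm_ell2_square infsum_ennreal summable_cmod_Rep_ell2)

lemma sum_cmod_Rep_ell2_le:
  assumes "finite F"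
  shows "(\<Sum>i\<in>F. (cmod (Rep_ell2 \<psi> i))\<^sup>2) \<le> (norm \<psi>)\<^sup>2"
  unfolding norm_ell2_square
  by (rule finite_sum_le_infsum) (simp_all add: assms summable_cmod_Rep_ell2)

lemma cmod_Rep_ell2_le: "cmod (Rep_ell2 \<psi> i) \<le> norm \<psi>"
  using sum_cmod_Rep_ell2_le[of "{i}" \<psi>] by (simp add: power2_le_iff_abs_le)

instance ell2 :: (type) complete_space
proof
  fix X :: "nat \<Rightarrow> 'a ell2"
  assume X: "Cauchy X"
  have "Cauchy (\<lambda>n. Rep_ell2 (X n) i)" for i
  proof (rule CauchyI)
    fix e :: real assume "0 < e"
    then obtain M where M: "\<And>m n. M \<le> m \<Longrightarrow> M \<le> n \<Longrightarrow> norm (X m - X n) < e"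
      using CauchyD[OF X] by blast
    have "norm (Rep_ell2 (X m) i - Rep_ell2 (X n) i) \<le> norm (X m - X n)" for m n
      using cmod_Rep_ell2_le[of "X m - X n" i] by (simp add: minus_ell2.rep_eq)
    then show "\<exists>M. \<forall>m\<ge>M. \<forall>n\<ge>M. norm (Rep_ell2 (X m) i - Rep_ell2 (X n) i) < e"
      using M by (meson le_less_trans)
  qed
  then have "\<exists>l. (\<lambda>n. Rep_ell2 (X n) i) \<longlonglongrightarrow> l" for i
    by (simp add: Cauchy_convergent_iff convergent_def)
  then obtain f where f: "\<And>i. (\<lambda>n. Rep_ell2 (X n) i) \<longlonglongrightarrow> f i"
    by metis
  \<comment> \<open>Serves twice: with \<phi> = 0 and a bound \<open>K\<close> on the norms it makes
    the coordinatewise limit square summable, and with \<phi> = \<open>X m\<close> it gives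
    convergence in norm.\<close>
  have tail: "(\<Sum>i\<in>F. (cmod (Rep_ell2 \<phi> i - f i))\<^sup>2) \<le> e\<^sup>2"
    if "finite F" "\<And>n. N \<le> n \<Longrightarrow> norm (\<phi> - X n) \<le> e" for F \<phi> N and e :: real
  proof (rule LIMSEQ_le_const2)
    show "(\<lambda>n. \<Sum>i\<in>F. (cmod (Rep_ell2 \<phi> i - Rep_ell2 (X n) i))\<^sup>2) \<longlonglongrightarrow>
        (\<Sum>i\<in>F. (cmod (Rep_ell2 \<phi> i - f i))\<^sup>2)"
      by (intro tendsto_intros f)
    show "\<exists>N. \<forall>n\<ge>N. (\<Sum>i\<in>F. (cmod (Rep_ell2 \<phi> i - Rep_ell2 (X n) i))\<^sup>2) \<le> e\<^sup>2"
    proof (intro exI allI impI)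
      fix n assume "N \<le> n"
      have "(\<Sum>i\<in>F. (cmod (Rep_ell2 \<phi> i - Rep_ell2 (X n) i))\<^sup>2) \<le> (norm (\<phi> - X n))\<^sup>2"
        using sum_cmod_Rep_ell2_le[OF that(1), of "\<phi> - X n"] by (simp add: minus_ell2.rep_eq)
      also have "\<dots> \<le> e\<^sup>2"
        by (intro power_mono that(2) \<open>N \<le> n\<close>) simp
      finally show "(\<Sum>i\<in>F. (cmod (Rep_ell2 \<phi> i - Rep_ell2 (X n) i))\<^sup>2) \<le> e\<^sup>2" .
    qed
  qed
  obtain K where K: "\<And>n. norm (X n) \<le> K"
    using Cauchy_Bseq[OF X] by (auto simp: Bseq_def)
  have "square_summable f"
    unfolding square_summable_def
  proof (rule nonneg_bdd_above_summable_on)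
    show "bdd_above (sum (\<lambda>i. (cmod (f i))\<^sup>2) ` {F. F \<subseteq> UNIV \<and> finite F})"
      using tail[of _ 0 0 K] K by (intro bdd_aboveI2[of _ _ "K\<^sup>2"]) (auto simp: zero_ell2.rep_eq)
  qed simp
  then have Rep: "Rep_ell2 (ell2_of f) = f" by (rule Rep_ell2_of)
  have "X \<longlonglongrightarrow> ell2_of f"
  proof (rule LIMSEQ_I)
    fix e :: real assume "0 < e"
    then obtain N where N: "\<And>m n. N \<le> m \<Longrightarrow> N \<le> n \<Longrightarrow> norm (X m - X n) < e / 2"
      using CauchyD[OF X, of "e / 2"] by auto
    have "norm (X m - ell2_of f) < e" if "N \<le> m" for m
    proof -
      have "(norm (X m - ell2_of f))\<^sup>2 \<le> (e / 2)\<^sup>2"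
        unfolding norm_ell2_square
      proof (rule infsum_le_finite_sums[OF summable_cmod_Rep_ell2])
        fix F :: "'a set" assume "finite F"
        then show "(\<Sum>i\<in>F. (cmod (Rep_ell2 (X m - ell2_of f) i))\<^sup>2) \<le> (e / 2)\<^sup>2"
          using tail[of F N "X m" "e / 2"] N[OF that] by (simp add: minus_ell2.rep_eq Rep less_imp_le)
      qed
      then have "norm (X m - ell2_of f) \<le> e / 2"
        using \<open>0 < e\<close> by (simp add: power2_le_iff_abs_le)
      then show ?thesis using \<open>0 < e\<close> by simp
    qed
    then show "\<exists>N. \<forall>n\<ge>N. norm (X n - ell2_of f) < e" by blast
  qed
  then show "convergent X" by (rule convergentI)
qed

section \<open>Complex structure, hermitian operators and the modulus\<close>

lemma cinner_ket: "cinner (ket i) \<psi> = Rep_ell2 \<psi> i"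
proof -
  have "((\<lambda>j. cnj (Rep_ell2 (ket i) j) * Rep_ell2 \<psi> j) has_sum Rep_ell2 \<psi> i) UNIV"
    by (rule has_sum_finite_neutralI[of "{i}"]) (auto simp: ket.rep_eq)
  then show ?thesis by (simp add: cinner.rep_eq infsumI)
qed

lemma cinner_cscale_right: "cinner \<phi> (cscale c \<psi>) = c * cinner \<phi> \<psi>"
  by (simp add: cinner_commute[of \<phi>] cinner_cscale_left)

lemma cinner_add_right: "cinner \<phi> (\<psi> + \<xi>) = cinner \<phi> \<psi> + cinner \<phi> \<xi>"
  using cinner_add_left[of \<psi> \<xi> \<phi>]
  by (simp add: cinner_commute[of _ \<psi>] cinner_commute[of _ \<xi>] cinner_commute[of _ "\<psi> + \<xi>"])

text \<open>Conjugate linearity on the left makes the imaginary part a real inner product with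
  \<open>cscale \<i> \<phi>\<close>, which reduces complex statements to real ones.\<close>

lemma cinner_eq_inner: "cinner \<phi> \<psi> = Complex (\<phi> \<bullet> \<psi>) (cscale \<i> \<phi> \<bullet> \<psi>)"
  by (simp add: inner_ell2_def cinner_cscale_left complex_eq_iff)

lemma cscale_cscale: "cscale a (cscale b \<psi>) = cscale (a * b) \<psi>"
  by transfer (simp add: mult.assoc)

lemma cscale_scaleR: "cscale c (r *\<^sub>R \<psi>) = r *\<^sub>R cscale c \<psi>"
  by (simp add: scaleR_eq_cscale cscale_cscale mult.commute)

lemma cscale_add: "cscale c (\<phi> + \<psi>) = cscale c \<phi> + cscale c \<psi>"
  by transfer (simp add: distrib_left)

lemma cscale_diff: "cscale c (\<phi> - \<psi>) = cscale c \<phi> - cscale c \<psi>"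
  by transfer (simp add: right_diff_distrib)

lemma norm_cscale: "norm (cscale c \<psi>) = cmod c * norm \<psi>"
proof -
  have "cinner (cscale c \<psi>) (cscale c \<psi>) = of_real ((cmod c)\<^sup>2) * cinner \<psi> \<psi>"
    by (simp add: cinner_cscale_left cinner_cscale_right complex_norm_square mult_ac del: of_real_power)
  then have "(norm (cscale c \<psi>))\<^sup>2 = (cmod c * norm \<psi>)\<^sup>2"
    by (simp add: power2_norm_eq_inner inner_ell2_def power_mult_distrib)
  then show ?thesis by simp
qed

lemma bounded_linear_cscale: "bounded_linear (cscale c)"
  by (rule bounded_linear_intro[where K = "cmod c"])
    (simp_all add: cscale_add cscale_scaleR norm_cscale mult.commute)

text \<open>Symmetry for the real inner product together with complex homogeneity amounts to
  self-adjointness (\<open>hermitian_cinner\<close>), and the real operator theory applies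
  directly.\<close>

definition hermitian :: "('a ell2 \<Rightarrow> 'a ell2) \<Rightarrow> bool" where
  "hermitian A \<longleftrightarrow> symmetric_op A \<and> (\<forall>c \<psi>. A (cscale c \<psi>) = cscale c (A \<psi>))"

lemma hermitian_symmetric_op: "hermitian A \<Longrightarrow> symmetric_op A"
  by (simp add: hermitian_def)

lemma hermitian_cscale: "hermitian A \<Longrightarrow> A (cscale c \<psi>) = cscale c (A \<psi>)"
  by (simp add: hermitian_def)

lemma hermitian_bounded_op: "hermitian A \<Longrightarrow> bounded_op A"
  by (simp add: hermitian_def bounded_op_def symmetric_op_def)

lemma hermitian_cinner: "hermitian A \<Longrightarrow> cinner (A \<phi>) \<psi> = cinner \<phi> (A \<psi>)"
  using hermitian_cscale[of A \<i> \<phi>] symmetric_opD[OF hermitian_symmetric_op, of A]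
  by (simp add: cinner_eq_inner) (metis)

text \<open>\<open>adj\<close> is a definite description, so uniqueness has to be shown: inner
  products determine a vector.\<close>

lemma hermitian_adj:
  assumes "hermitian A"
  shows "adj A = A"
  unfolding adj_def
proof (rule the_equality)
  show "bounded_op A \<and> (\<forall>\<phi> \<psi>. cinner (A \<phi>) \<psi> = cinner \<phi> (A \<psi>))"
    using assms by (simp add: hermitian_bounded_op hermitian_cinner)
next
  fix B assume B: "bounded_op B \<and> (\<forall>\<phi> \<psi>. cinner (B \<phi>) \<psi> = cinner \<phi> (A \<psi>))"
  show "B = A"
  proof
    fix \<phi>
    have "B \<phi> \<bullet> \<psi> = A \<phi> \<bullet> \<psi>" for \<psi>
      using B hermitian_cinner[OF assms, of \<phi> \<psi>] by (simp add: inner_ell2_def)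
    then show "B \<phi> = A \<phi>" by (rule vector_eq_rdot[THEN iffD1, OF allI])
  qed
qed

lemma positive_op_iff: "positive_op P \<longleftrightarrow> hermitian P \<and> psd P"
proof
  assume P: "positive_op P"
  then have bl: "bounded_linear P" and sc: "\<And>c \<psi>. P (cscale c \<psi>) = cscale c (P \<psi>)"
    and real: "\<And>\<psi>. Im (cinner \<psi> (P \<psi>)) = 0" and nn: "\<And>\<psi>. 0 \<le> \<psi> \<bullet> P \<psi>"
    by (auto simp: positive_op_def bounded_op_def complex_is_Real_iff inner_ell2_def)
  have "P \<phi> \<bullet> \<psi> = \<phi> \<bullet> P \<psi>" for \<phi> \<psi>
  proof -
    \<comment> \<open>The imaginary part of the form at \<phi> + i \<psi> is the difference of the
      two sides.\<close>
    have "Re (cinner \<psi> (P \<phi>)) = Re (cinner \<phi> (P \<psi>))"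
      using real[of "\<phi> + cscale \<i> \<psi>"] real[of \<phi>] real[of \<psi>]
      by (simp add: linear_add[OF bounded_linear.linear[OF bl]] sc cinner_add_left cinner_add_right
          cinner_cscale_left cinner_cscale_right)
    then show ?thesis by (subst inner_commute) (simp add: inner_ell2_def)
  qed
  then show "hermitian P \<and> psd P"
    using bl sc nn by (simp add: hermitian_def psd_def symmetric_op_def)
next
  assume P: "hermitian P \<and> psd P"
  have "cinner \<psi> (P \<psi>) = cnj (cinner \<psi> (P \<psi>))" for \<psi>
    using hermitian_cinner[of P \<psi> \<psi>] P by (subst (2) cinner_commute) simp
  then show "positive_op P"
    using P hermitian_bounded_op psd_nonneg[of P]
    by (auto simp: positive_op_def inner_ell2_def Reals_cnj_iff)
qed

lemma positive_op_hermitian: "positive_op P \<Longrightarrow> hermitian P"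
  by (simp add: positive_op_iff)

lemma positive_op_psd: "positive_op P \<Longrightarrow> psd P"
  by (simp add: positive_op_iff)

lemma psd_square:
  assumes "symmetric_op A"
  shows "psd (\<lambda>x. A (A x))"
proof -
  have "0 \<le> x \<bullet> A (A x)" for x
    using inner_ge_zero[of "A x"] by (simp add: symmetric_opD[OF assms])
  then show ?thesis
    using assms bounded_linear_compose[of A A] by (simp add: psd_def symmetric_op_def)
qed

text \<open>The root is complex homogeneous because it commutes with every \<open>cscale c\<close>,
  as \<open>R\<close> does.\<close>

lemma positive_op_sqrt_exists:
  assumes "positive_op R"
  shows "\<exists>M. positive_op M \<and> (\<forall>\<psi>. M (M \<psi>) = R \<psi>)"
proof -
  obtain M where M: "psd M" "\<forall>x. M (M x) = R x"
    "\<forall>C. bounded_linear C \<longrightarrow> (\<forall>x. C (R x) = R (C x)) \<longrightarrow> (\<forall>x. C (M x) = M (C x))"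
    using psd_sqrt_exists[OF positive_op_psd[OF assms]] by blast
  have "M (cscale c \<psi>) = cscale c (M \<psi>)" for c \<psi>
    using M(3) bounded_linear_cscale hermitian_cscale[OF positive_op_hermitian[OF assms]] by metis
  then have "positive_op M"
    using M(1) by (simp add: positive_op_iff hermitian_def psd_symmetric_op)
  with M(2) show ?thesis by blast
qed

text \<open>Since \<open>adj A\<close> is \<open>A\<close>, existence and uniqueness of the positive
  root of the square evaluate the definite description in \<open>abs_op\<close>.\<close>

lemma abs_op_hermitian:
  assumes A: "hermitian A"
  shows "positive_op (abs_op A)" "abs_op A (abs_op A \<psi>) = A (A \<psi>)"
proof -
  have "psd (\<lambda>\<psi>. A (A \<psi>))" by (rule psd_square[OF hermitian_symmetric_op[OF A]])
  then have "positive_op (\<lambda>\<psi>. A (A \<psi>))"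
    using A by (simp add: positive_op_iff hermitian_def psd_symmetric_op)
  then obtain M where M: "positive_op M" "\<forall>\<psi>. M (M \<psi>) = A (A \<psi>)"
    using positive_op_sqrt_exists by blast
  have "abs_op A = M"
    unfolding abs_op_def hermitian_adj[OF A]
  proof (rule the_equality)
    show "positive_op M \<and> M \<circ> M = A \<circ> A" using M by auto
    fix P assume "positive_op P \<and> P \<circ> P = A \<circ> A"
    then show "P = M"
      using M by (intro psd_sqrt_unique positive_op_psd) (auto simp: fun_eq_iff)
  qed
  with M show "positive_op (abs_op A)" "abs_op A (abs_op A \<psi>) = A (A \<psi>)" by simp_all
qed

section \<open>Traces and the trace norm bound\<close>

lemma pos_trace_inner: "pos_trace P = (\<Sum>\<^sub>\<infinity>i. ennreal (ket i \<bullet> P (ket i)))"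
  by (simp add: pos_trace_def inner_ell2_def)

lemma pos_trace_scaleR:
  assumes "0 \<le> c"
  shows "pos_trace (\<lambda>\<psi>. c *\<^sub>R P \<psi>) = ennreal c * pos_trace P"
  by (simp add: pos_trace_inner ennreal_mult' assms infsum_cmult_ennreal)

lemma pos_trace_add:
  assumes "positive_op P" "positive_op Q"
  shows "pos_trace (\<lambda>\<psi>. P \<psi> + Q \<psi>) = pos_trace P + pos_trace Q"
  using assms
  by (simp add: pos_trace_inner inner_add_right positive_op_psd psd_nonneg infsum_add ennreal_summable_on)

lemma pos_trace_square:
  assumes "symmetric_op M"
  shows "pos_trace (\<lambda>\<psi>. M (M \<psi>)) = (\<Sum>\<^sub>\<infinity>i. ennreal ((norm (M (ket i)))\<^sup>2))"
  by (simp add: pos_trace_inner power2_norm_eq_inner symmetric_opD[OF assms])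

text \<open>With M^2 = R, both traces are squared Hilbert-Schmidt norms. Exchanging the double sum
  over matrix elements replaces M S by its adjoint S M, where the contraction acts last.\<close>

lemma pos_trace_sandwich_le:
  assumes R: "positive_op R" and S: "hermitian S" and contr: "\<And>\<psi>. norm (S \<psi>) \<le> norm \<psi>"
  shows "pos_trace (\<lambda>\<psi>. S (R (S \<psi>))) \<le> pos_trace R"
proof -
  obtain M where M: "positive_op M" "\<forall>\<psi>. M (M \<psi>) = R \<psi>"
    using positive_op_sqrt_exists[OF R] by blast
  note herM = positive_op_hermitian[OF M(1)]
  note symM = hermitian_symmetric_op[OF herM]
  have "ket i \<bullet> S (R (S (ket i))) = (norm (M (S (ket i))))\<^sup>2" for i
    using M(2) by (simp add: power2_norm_eq_inner symmetric_opD[OF symM]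
        flip: symmetric_opD[OF hermitian_symmetric_op[OF S]])
  then have "pos_trace (\<lambda>\<psi>. S (R (S \<psi>))) = (\<Sum>\<^sub>\<infinity>i. \<Sum>\<^sub>\<infinity>j. ennreal ((cmod (cinner (ket j) (M (S (ket i)))))\<^sup>2))"
    by (simp add: pos_trace_inner ennreal_norm_ell2_square cinner_ket)
  also have "\<dots> = (\<Sum>\<^sub>\<infinity>j. \<Sum>\<^sub>\<infinity>i. ennreal ((cmod (cinner (ket j) (M (S (ket i)))))\<^sup>2))"
    by (rule infsum_swap_ennreal)
  also have "\<dots> = (\<Sum>\<^sub>\<infinity>j. ennreal ((norm (S (M (ket j))))\<^sup>2))"
  proof (rule infsum_cong)
    fix j
    have "cmod (cinner (ket j) (M (S (ket i)))) = cmod (Rep_ell2 (S (M (ket j))) i)" for i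
    proof -
      have "cinner (ket j) (M (S (ket i))) = cnj (cinner (ket i) (S (M (ket j))))"
        by (subst cinner_commute) (simp add: hermitian_cinner[OF herM] hermitian_cinner[OF S])
      then show ?thesis by (simp add: cinner_ket)
    qed
    then show "(\<Sum>\<^sub>\<infinity>i. ennreal ((cmod (cinner (ket j) (M (S (ket i)))))\<^sup>2)) =
        ennreal ((norm (S (M (ket j))))\<^sup>2)"
      by (simp add: ennreal_norm_ell2_square)
  qed
  also have "\<dots> \<le> (\<Sum>\<^sub>\<infinity>j. ennreal ((norm (M (ket j)))\<^sup>2))"
    by (intro infsum_mono ennreal_leI power_mono contr ennreal_summable_on) simp_all
  also have "\<dots> = pos_trace R"
    using M(2) by (simp flip: pos_trace_square[OF symM])
  finally show ?thesis .
qed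

text \<open>A finite real truncation of the trace, so that limits can be taken in the reals.\<close>

lemma sum_inner_ket_le_pos_trace:
  assumes "finite F" "pos_trace P \<le> ennreal r" "0 \<le> r" "\<And>\<psi>. 0 \<le> \<psi> \<bullet> P \<psi>"
  shows "(\<Sum>i\<in>F. ket i \<bullet> P (ket i)) \<le> r"
proof -
  have "ennreal (\<Sum>i\<in>F. ket i \<bullet> P (ket i)) = (\<Sum>i\<in>F. ennreal (ket i \<bullet> P (ket i)))"
    using assms(4) by (intro sum_ennreal[symmetric]) simp
  also have "\<dots> \<le> pos_trace P"
    unfolding pos_trace_inner by (rule sum_le_infsum_ennreal[OF assms(1)])
  finally show ?thesis
    using assms(2,3) by (meson ennreal_le_iff order_trans)
qed

text \<open>An infinite trace of \<open>R\<close> is trivial. Otherwise each diagonal element of the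
  modulus is a limit of <S_n e_i, A e_i>, which polarization bounds by the forms of
  \<open>R\<close>.\<close>

lemma trace_norm_le:
  assumes A: "hermitian A" and R: "positive_op R"
    and le: "\<And>\<psi>. \<bar>\<psi> \<bullet> A \<psi>\<bar> \<le> \<psi> \<bullet> R \<psi>"
  shows "trace_norm A \<le> pos_trace R"
proof (cases "pos_trace R")
  case (real r)
  note symA = hermitian_symmetric_op[OF A]
  note symR = psd_symmetric_op[OF positive_op_psd[OF R]]
  obtain S where S: "\<forall>n. symmetric_op (S n)" "\<forall>n x. norm (S n x) \<le> norm x"
    "\<forall>x. (\<lambda>n. S n (A x)) \<longlonglongrightarrow> abs_op A x"
    "\<forall>n C. linear C \<longrightarrow> (\<forall>x. C (A x) = A (C x)) \<longrightarrow> (\<forall>x. C (S n x) = S n (C x))"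
    using sign_approximation[OF symA positive_op_psd[OF abs_op_hermitian(1)[OF A]] abs_op_hermitian(2)[OF A]]
    by blast
  have herS: "hermitian (S n)" for n
    unfolding hermitian_def
    using S(1) S(4)[rule_format, OF bounded_linear.linear[OF bounded_linear_cscale]]
    by (simp add: hermitian_cscale[OF A])
  \<comment> \<open>The operators converge only strongly, so the limit is taken for finitely many
    basis vectors at a time.\<close>
  have "(\<Sum>i\<in>F. ket i \<bullet> abs_op A (ket i)) \<le> r" if F: "finite F" for F
  proof (rule LIMSEQ_le_const2)
    show "(\<lambda>n. \<Sum>i\<in>F. ket i \<bullet> S n (A (ket i))) \<longlonglongrightarrow> (\<Sum>i\<in>F. ket i \<bullet> abs_op A (ket i))"
      using S(3) by (intro tendsto_intros) simp
    show "\<exists>N. \<forall>n\<ge>N. (\<Sum>i\<in>F. ket i \<bullet> S n (A (ket i))) \<le> r"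
    proof (intro exI allI impI)
      fix n
      note symS = S(1)[rule_format, of n]
      have "ket i \<bullet> S n (A (ket i)) \<le> (ket i \<bullet> S n (R (S n (ket i))) + ket i \<bullet> R (ket i)) / 2" for i
        using inner_le_of_abs_inner_le[OF symA symR le, of "S n (ket i)" "ket i"]
        by (simp add: symmetric_opD[OF symS])
      then have "(\<Sum>i\<in>F. ket i \<bullet> S n (A (ket i))) \<le>
          ((\<Sum>i\<in>F. ket i \<bullet> S n (R (S n (ket i)))) + (\<Sum>i\<in>F. ket i \<bullet> R (ket i))) / 2"
        unfolding sum.distrib[symmetric] sum_divide_distrib by (rule sum_mono)
      also have "(\<Sum>i\<in>F. ket i \<bullet> S n (R (S n (ket i)))) \<le> r"
        using pos_trace_sandwich_le[OF R herS, of n] S(2) real psd_nonneg[OF positive_op_psd[OF R]]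
        by (intro sum_inner_ket_le_pos_trace[OF F, where P = "\<lambda>\<psi>. S n (R (S n \<psi>))"])
          (simp_all flip: symmetric_opD[OF symS])
      also have "(\<Sum>i\<in>F. ket i \<bullet> R (ket i)) \<le> r"
        using real psd_nonneg[OF positive_op_psd[OF R]]
        by (intro sum_inner_ket_le_pos_trace[OF F]) simp_all
      finally show "(\<Sum>i\<in>F. ket i \<bullet> S n (A (ket i))) \<le> r" by simp
    qed
  qed
  then have "ennreal (\<Sum>i\<in>F. ket i \<bullet> abs_op A (ket i)) \<le> ennreal r" if "finite F" for F
    using that by (intro ennreal_leI)
  then show ?thesis
    using psd_nonneg[OF positive_op_psd[OF abs_op_hermitian(1)[OF A]]]
    unfolding trace_norm_def pos_trace_inner[of "abs_op A"] real
    by (intro infsum_le_finite_sums ennreal_summable_on) simp_all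
qed simp


section \<open>The protocol\<close>

lemma hermitian_scaleR: "hermitian A \<Longrightarrow> hermitian (\<lambda>\<psi>. c *\<^sub>R A \<psi>)"
  by (simp add: hermitian_def symmetric_op_scaleR cscale_scaleR)

lemma hermitian_add:
  assumes "hermitian A" "hermitian B"
  shows "hermitian (\<lambda>\<psi>. A \<psi> + B \<psi>)"
  using assms bounded_linear_add[of A B]
  by (simp add: hermitian_def symmetric_op_def inner_add_left inner_add_right cscale_add)

lemma hermitian_diff:
  assumes "hermitian A" "hermitian B"
  shows "hermitian (\<lambda>\<psi>. A \<psi> - B \<psi>)"
  using assms bounded_linear_sub[of A B]
  by (simp add: hermitian_def symmetric_op_def inner_diff_left inner_diff_right cscale_diff)

lemma hermitian_sandwich:
  assumes "hermitian A" "hermitian U"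
  shows "hermitian (\<lambda>\<psi>. U (A (U \<psi>)))"
  using assms bounded_linear_compose[OF _ bounded_linear_compose, of U A U]
  by (simp add: hermitian_def symmetric_op_def)

lemma positive_op_scaleR: "positive_op P \<Longrightarrow> 0 \<le> c \<Longrightarrow> positive_op (\<lambda>\<psi>. c *\<^sub>R P \<psi>)"
  by (simp add: positive_op_iff hermitian_scaleR psd_scaleR)

lemma positive_op_add:
  assumes "positive_op P" "positive_op Q"
  shows "positive_op (\<lambda>\<psi>. P \<psi> + Q \<psi>)"
  using assms hermitian_add[of P Q]
  by (simp add: positive_op_iff psd_def hermitian_symmetric_op inner_add_right)

lemma positive_op_sandwich:
  assumes "positive_op P" "hermitian U"
  shows "positive_op (\<lambda>\<psi>. U (P (U \<psi>)))"
proof -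
  have "0 \<le> \<psi> \<bullet> U (P (U \<psi>))" for \<psi>
    using psd_nonneg[OF positive_op_psd[OF assms(1)], of "U \<psi>"]
    by (simp add: symmetric_opD[OF hermitian_symmetric_op[OF assms(2)]])
  then show ?thesis
    using hermitian_sandwich[OF positive_op_hermitian[OF assms(1)] assms(2)]
    by (simp add: positive_op_iff psd_def hermitian_symmetric_op)
qed

lemma density_op_convex:
  assumes "density_op \<rho>" "density_op \<sigma>" "0 \<le> c" "c \<le> 1"
  shows "density_op (\<lambda>\<psi>. (1 - c) *\<^sub>R \<rho> \<psi> + c *\<^sub>R \<sigma> \<psi>)"
proof -
  have "ennreal (1 - c) + ennreal c = 1"
    using assms(3,4) by (simp flip: ennreal_plus)
  then show ?thesis
    using assms
    by (simp add: density_op_def pos_trace_add positive_op_add positive_op_scaleR pos_trace_scaleR)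
qed

lemma positive_op_pure_state: "positive_op (pure_state \<psi>)"
proof -
  have sq: "cinner \<phi> (pure_state \<psi> \<xi>) = cinner \<phi> \<psi> * cinner \<psi> \<xi>" for \<phi> \<xi>
    by (simp add: pure_state_def cinner_cscale_right)
  have sym: "pure_state \<psi> \<phi> \<bullet> \<xi> = \<phi> \<bullet> pure_state \<psi> \<xi>" for \<phi> \<xi>
  proof -
    have "cinner (pure_state \<psi> \<phi>) \<xi> = cinner \<phi> (pure_state \<psi> \<xi>)"
      by (simp add: pure_state_def cinner_cscale_left cinner_cscale_right cinner_commute[of \<phi> \<psi>])
    then show ?thesis by (simp add: inner_ell2_def)
  qed
  have "bounded_linear (pure_state \<psi>)"
  \<comment> \<open>The 2 comes from bounding real and imaginary part of \<open>cinner\<close>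
    separately by the real Cauchy-Schwarz inequality.\<close>
  proof (rule bounded_linear_intro[where K = "2 * (norm \<psi> * norm \<psi>)"])
    fix \<phi> \<xi> and r :: real
    show "pure_state \<psi> (\<phi> + \<xi>) = pure_state \<psi> \<phi> + pure_state \<psi> \<xi>"
      by (simp add: pure_state_def cinner_add_right ell2.scale_left_distrib)
    show "pure_state \<psi> (r *\<^sub>R \<phi>) = r *\<^sub>R pure_state \<psi> \<phi>"
      by (simp add: pure_state_def scaleR_eq_cscale cinner_cscale_right cscale_cscale)
    have "cmod (cinner \<psi> \<phi>) \<le> \<bar>\<psi> \<bullet> \<phi>\<bar> + \<bar>cscale \<i> \<psi> \<bullet> \<phi>\<bar>"
      using cmod_le[of "cinner \<psi> \<phi>"] by (simp add: cinner_eq_inner)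
    also have "\<dots> \<le> norm \<psi> * norm \<phi> + norm (cscale \<i> \<psi>) * norm \<phi>"
      by (intro add_mono Cauchy_Schwarz_ineq2)
    finally have "cmod (cinner \<psi> \<phi>) \<le> 2 * (norm \<psi> * norm \<phi>)"
      by (simp add: norm_cscale mult_ac)
    then have "cmod (cinner \<psi> \<phi>) * norm \<psi> \<le> 2 * (norm \<psi> * norm \<phi>) * norm \<psi>"
      by (intro mult_right_mono) simp_all
    then show "norm (pure_state \<psi> \<phi>) \<le> norm \<phi> * (2 * (norm \<psi> * norm \<psi>))"
      by (simp add: pure_state_def norm_cscale mult_ac)
  qed
  moreover have "pure_state \<psi> (cscale c \<phi>) = cscale c (pure_state \<psi> \<phi>)" for c \<phi>
    by (simp add: pure_state_def cinner_cscale_right cscale_cscale)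
  moreover have "0 \<le> \<phi> \<bullet> pure_state \<psi> \<phi>" for \<phi>
    by (simp add: inner_ell2_def sq cinner_commute[of \<psi> \<phi>])
  ultimately show ?thesis
    using sym by (simp add: positive_op_iff hermitian_def psd_def symmetric_op_def)
qed

lemma pos_trace_pure_state: "pos_trace (pure_state \<psi>) = ennreal ((norm \<psi>)\<^sup>2)"
proof -
  have "ket i \<bullet> pure_state \<psi> (ket i) = (cmod (Rep_ell2 \<psi> i))\<^sup>2" for i
    by (simp add: inner_ell2_def pure_state_def cinner_cscale_right cinner_ket
        cinner_commute[of \<psi> "ket i"] cmod_power2 flip: power2_eq_square)
  then show ?thesis by (simp add: pos_trace_inner ennreal_norm_ell2_square)
qed

lemma density_op_pure_state: "norm \<psi> = 1 \<Longrightarrow> density_op (pure_state \<psi>)"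
  by (simp add: density_op_def positive_op_pure_state pos_trace_pure_state)

section \<open>The encoding and the eavesdropper's state\<close>

lemma Rep_encode:
  "Rep_ell2 (encode x y \<psi>) (m, n) = (-1) ^ (x * m + y * n) * Rep_ell2 \<psi> (m, n)"
  by (simp add: encode_def Rep_phase_a Rep_phase_b power_add)

lemma Rep_ell2_eqI: "(\<And>m n. Rep_ell2 \<phi> (m, n) = Rep_ell2 \<psi> (m, n)) \<Longrightarrow> \<phi> = \<psi>"
  by (auto simp: fun_eq_iff simp flip: Rep_ell2_inject)

lemma cinner_encode: "cinner (encode x y \<phi>) \<psi> = cinner \<phi> (encode x y \<psi>)"
  unfolding cinner.rep_eq by (rule infsum_cong) (auto simp: Rep_encode)

lemma encode_encode: "encode x y (encode x y \<psi>) = \<psi>"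
  by (rule Rep_ell2_eqI) (simp add: Rep_encode flip: mult.assoc power_mult_distrib)

lemma encode_cscale: "encode x y (cscale c \<psi>) = cscale c (encode x y \<psi>)"
  by (rule Rep_ell2_eqI) (simp add: Rep_encode cscale.rep_eq)

lemma hermitian_encode: "hermitian (encode x y)"
proof -
  have sym: "encode x y \<phi> \<bullet> \<psi> = \<phi> \<bullet> encode x y \<psi>" for \<phi> \<psi>
    by (simp add: inner_ell2_def cinner_encode)
  have "norm (encode x y \<psi>) = norm \<psi>" for \<psi>
    by (simp add: norm_eq_sqrt_inner sym encode_encode)
  then have "bounded_linear (encode x y)"
    by (intro bounded_linear_intro[where K = 1] Rep_ell2_eqI)
      (simp_all add: Rep_encode plus_ell2.rep_eq scaleR_ell2.rep_eq distrib_left)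
  with sym show ?thesis by (simp add: hermitian_def symmetric_op_def encode_cscale)
qed

lemma encode_ket: "encode x y (ket (m, n)) = cscale ((-1) ^ (x * m + y * n)) (ket (m, n))"
  by (rule Rep_ell2_eqI) (auto simp: Rep_encode cscale.rep_eq ket.rep_eq)

text \<open>The encoding multiplies each basis vector by a sign, which occurs twice in a diagonal
  matrix element and cancels.\<close>

lemma pos_trace_encode:
  assumes "hermitian P"
  shows "pos_trace (\<lambda>\<psi>. encode x y (P (encode x y \<psi>))) = pos_trace P"
proof -
  have "ket i \<bullet> encode x y (P (encode x y (ket i))) = ket i \<bullet> P (ket i)" for i
  proof (cases i)
    case (Pair m n)
    define s where "s = ((-1) ^ (x * m + y * n) :: complex)"
    have "ket i \<bullet> encode x y (P (encode x y (ket i))) = cscale s (ket i) \<bullet> cscale s (P (ket i))"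
      by (simp add: Pair encode_ket hermitian_cscale[OF assms] s_def
          flip: symmetric_opD[OF hermitian_symmetric_op[OF hermitian_encode]])
    also have "\<dots> = ket i \<bullet> P (ket i)"
      by (simp add: inner_ell2_def cinner_cscale_left cinner_cscale_right s_def
          flip: mult.assoc power_mult_distrib)
    finally show ?thesis .
  qed
  then show ?thesis by (simp add: pos_trace_inner)
qed

lemma eavesdropper_state_eq:
  "eavesdropper_state \<rho> x = (\<lambda>\<psi>. (1/2) *\<^sub>R
    (encode x 0 (\<rho> (encode x 0 \<psi>)) + encode x 1 (\<rho> (encode x 1 \<psi>))))"
  by (rule ext) (simp add: eavesdropper_state_def hermitian_adj[OF hermitian_encode])

lemma hermitian_eavesdropper_state: "hermitian \<rho> \<Longrightarrow> hermitian (eavesdropper_state \<rho> x)"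
  unfolding eavesdropper_state_eq
  by (rule hermitian_scaleR,
      rule hermitian_add[OF hermitian_sandwich[OF _ hermitian_encode] hermitian_sandwich[OF _ hermitian_encode]])

lemma positive_op_eavesdropper_state: "positive_op \<rho> \<Longrightarrow> positive_op (eavesdropper_state \<rho> x)"
  unfolding eavesdropper_state_eq
  by (rule positive_op_scaleR,
      rule positive_op_add[OF positive_op_sandwich[OF _ hermitian_encode] positive_op_sandwich[OF _ hermitian_encode]])
    simp_all

lemma pos_trace_eavesdropper_state:
  assumes "positive_op \<rho>"
  shows "pos_trace (eavesdropper_state \<rho> x) = pos_trace \<rho>"
proof -
  have "pos_trace (eavesdropper_state \<rho> x) = ennreal (1/2) * (pos_trace \<rho> + pos_trace \<rho>)"
    unfolding eavesdropper_state_eq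
    by (simp only: pos_trace_scaleR pos_trace_add positive_op_sandwich assms hermitian_encode
        pos_trace_encode positive_op_hermitian zero_le_divide_1_iff zero_le_numeral)
  also have "\<dots> = pos_trace \<rho>"
  proof -
    have "ennreal (1/2) * (pos_trace \<rho> + pos_trace \<rho>) = (ennreal (1/2) + ennreal (1/2)) * pos_trace \<rho>"
      by (simp add: distrib_left distrib_right)
    also have "ennreal (1/2) + ennreal (1/2) = 1"
      by (subst ennreal_plus[symmetric]) simp_all
    finally show ?thesis by simp
  qed
  finally show ?thesis .
qed

lemma density_op_eavesdropper_state: "density_op \<rho> \<Longrightarrow> density_op (eavesdropper_state \<rho> x)"
  by (simp add: density_op_def positive_op_eavesdropper_state pos_trace_eavesdropper_state)

lemma lossy_eq: "lossy loss \<rho> = (\<lambda>\<psi>. (1 - loss) *\<^sub>R \<rho> \<psi> + loss *\<^sub>R pure_state vacuum \<psi>)"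
  by (rule ext) (rule lossy_def)

lemma norm_vacuum: "norm vacuum = 1"
  by (simp add: norm_eq_sqrt_inner inner_ell2_def vacuum_def cinner_ket ket.rep_eq)

lemma density_op_lossy: "density_op \<rho> \<Longrightarrow> loss \<in> {0..1} \<Longrightarrow> density_op (lossy loss \<rho>)"
  unfolding lossy_eq
  by (rule density_op_convex) (simp_all add: density_op_pure_state norm_vacuum)

lemma eavesdropper_state_convex:
  "eavesdropper_state (\<lambda>\<psi>. a *\<^sub>R \<rho> \<psi> + b *\<^sub>R \<sigma> \<psi>) x =
    (\<lambda>\<psi>. a *\<^sub>R eavesdropper_state \<rho> x \<psi> + b *\<^sub>R eavesdropper_state \<sigma> x \<psi>)"
proof -
  note lin = symmetric_op_linear[OF hermitian_symmetric_op[OF hermitian_encode]]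
  show ?thesis
    by (rule ext) (simp add: eavesdropper_state_eq linear_add[OF lin] linear_scale[OF lin] algebra_simps)
qed


section \<open>States of fixed photon number\<close>

text \<open>A condition on coefficients that contains \<open>fixed_number_space N\<close> and on
  which signs can be compared entrywise.\<close>

definition photon_number :: "nat \<Rightarrow> fock \<Rightarrow> bool" where
  "photon_number N \<psi> \<longleftrightarrow> (\<forall>m n. m + n \<noteq> N \<longrightarrow> Rep_ell2 \<psi> (m, n) = 0)"

text \<open>True also for the default value 0 of \<open>ell2_of\<close>, so the creation operators
  can be treated without checking square summability.\<close>

lemma Rep_ell2_of_eq_0: "f i = 0 \<Longrightarrow> Rep_ell2 (ell2_of f) i = 0"
  by (cases "square_summable f") (simp_all add: Rep_ell2_of, simp add: ell2_of_def zero_ell2.rep_eq)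

text \<open>At \<open>m = 0\<close> the truncated \<open>m - 1\<close> is harmless because the
  factor sqrt 0 vanishes.\<close>

lemma photon_number_create_a: "photon_number N \<psi> \<Longrightarrow> photon_number (Suc N) (create_a \<psi>)"
  unfolding photon_number_def create_a_def
  by (intro allI impI Rep_ell2_of_eq_0) (auto split: nat_diff_split)

lemma photon_number_create_b: "photon_number N \<psi> \<Longrightarrow> photon_number (Suc N) (create_b \<psi>)"
  unfolding photon_number_def create_b_def
  by (intro allI impI Rep_ell2_of_eq_0) (auto split: nat_diff_split)

lemma photon_number_vacuum: "photon_number 0 vacuum"
  by (simp add: photon_number_def vacuum_def ket.rep_eq)

lemma photon_number_fixed_number_space:
  assumes "\<psi> \<in> fixed_number_space n"
  shows "photon_number n \<psi>"
  using assms unfolding fixed_number_space_def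
proof (induction rule: ell2.span_induct_alt)
  case base
  then show ?case by (simp add: photon_number_def zero_ell2.rep_eq)
next
  case (step c \<phi> \<psi>)
  then obtain k where k: "k \<le> n" "\<phi> = (create_a ^^ k) ((create_b ^^ (n - k)) vacuum)" by blast
  have b: "photon_number j ((create_b ^^ j) vacuum)" for j
    by (induction j) (simp_all add: photon_number_vacuum photon_number_create_b)
  have "photon_number (n - k + j) ((create_a ^^ j) ((create_b ^^ (n - k)) vacuum))" for j
    by (induction j) (simp_all add: b photon_number_create_a)
  from this[of k] k have "photon_number n \<phi>" by simp
  with step.IH show ?case
    by (simp add: photon_number_def plus_ell2.rep_eq cscale.rep_eq)
qed

text \<open>Where m + n = N, the sign (-1)^m equals (-1)^N (-1)^n: up to a global sign, Alice's flip
  acts like a flip by Bob.\<close>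

lemma encode_photon_number:
  assumes "photon_number N \<psi>"
  shows "encode 1 y \<psi> = cscale ((-1) ^ N) (encode 0 (1 + y) \<psi>)"
proof (rule Rep_ell2_eqI)
  fix m n
  show "Rep_ell2 (encode 1 y \<psi>) (m, n) = Rep_ell2 (cscale ((-1) ^ N) (encode 0 (1 + y) \<psi>)) (m, n)"
  proof (cases "m + n = N")
    case True
    have "(-1) ^ (m + y * n) = ((-1) ^ (m + n) * (-1) ^ (n + y * n) :: complex)"
      by (simp add: power_add flip: power_mult_distrib)
    then show ?thesis using True by (simp add: Rep_encode cscale.rep_eq)
  next
    case False
    then show ?thesis using assms by (simp add: photon_number_def Rep_encode cscale.rep_eq)
  qed
qed

lemma pure_state_sign: "s * cnj s = 1 \<Longrightarrow> pure_state (cscale s \<psi>) = pure_state \<psi>"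
  by (rule ext) (simp add: pure_state_def cinner_cscale_left cscale_cscale mult_ac)

lemma encode_pure_state: "encode x y (pure_state \<psi> (encode x y \<phi>)) = pure_state (encode x y \<psi>) \<phi>"
  by (simp add: pure_state_def encode_cscale cinner_encode)

lemma encode_0_2: "encode 0 2 = encode 0 0"
  by (rule ext, rule Rep_ell2_eqI) (simp add: Rep_encode power_mult)

text \<open>Global signs disappear in pure states. Changing Alice's input shifts Bob's bit from y to
  1 + y, and \<open>encode_0_2\<close> shows that this only permutes the two summands.\<close>

lemma eavesdropper_pure_state:
  assumes "photon_number N \<psi>"
  shows "eavesdropper_state (pure_state \<psi>) 1 = eavesdropper_state (pure_state \<psi>) 0"
proof -
  have "pure_state (encode 1 y \<psi>) = pure_state (encode 0 (1 + y) \<psi>)" for y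
    unfolding encode_photon_number[OF assms]
    by (rule pure_state_sign) (simp flip: power_mult_distrib)
  then show ?thesis
    using encode_0_2 by (simp add: eavesdropper_state_eq encode_pure_state add.commute numeral_2_eq_2)
qed

section \<open>Contraction of the trace norm and conclusion\<close>

text \<open>The same average taken of \<open>abs_op A\<close> dominates: the bound of the form of
  \<open>A\<close> by that of its modulus is applied at the two encoded vectors, and averaging
  preserves the trace.\<close>

lemma trace_norm_eavesdropper_le:
  assumes A: "hermitian A" and c: "0 \<le> c"
  shows "trace_norm (\<lambda>\<psi>. c *\<^sub>R eavesdropper_state A x \<psi>) \<le> ennreal c * trace_norm A"
proof -
  note D = abs_op_hermitian[OF A]
  let ?R = "\<lambda>\<psi>. c *\<^sub>R eavesdropper_state (abs_op A) x \<psi>"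
  have "trace_norm (\<lambda>\<psi>. c *\<^sub>R eavesdropper_state A x \<psi>) \<le> pos_trace ?R"
  proof (rule trace_norm_le)
    show "hermitian (\<lambda>\<psi>. c *\<^sub>R eavesdropper_state A x \<psi>)"
      by (intro hermitian_scaleR hermitian_eavesdropper_state A)
    show "positive_op ?R"
      by (intro positive_op_scaleR positive_op_eavesdropper_state D c)
    fix \<psi>
    have sandwich: "\<psi> \<bullet> encode x y \<phi> = encode x y \<psi> \<bullet> \<phi>" for y \<phi>
      by (simp add: symmetric_opD[OF hermitian_symmetric_op[OF hermitian_encode]])
    have "\<bar>\<phi> \<bullet> A \<phi>\<bar> \<le> \<phi> \<bullet> abs_op A \<phi>" for \<phi>
      by (rule abs_inner_le_modulus[OF hermitian_symmetric_op[OF A] positive_op_psd[OF D(1)] D(2)])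
    from this[of "encode x 0 \<psi>"] this[of "encode x 1 \<psi>"]
    have "\<bar>\<psi> \<bullet> eavesdropper_state A x \<psi>\<bar> \<le> \<psi> \<bullet> eavesdropper_state (abs_op A) x \<psi>"
      by (simp add: eavesdropper_state_eq inner_add_right sandwich)
    then show "\<bar>\<psi> \<bullet> (c *\<^sub>R eavesdropper_state A x \<psi>)\<bar> \<le> \<psi> \<bullet> ?R \<psi>"
      using c by (simp add: abs_mult mult_left_mono)
  qed
  also have "\<dots> = ennreal c * trace_norm A"
    by (simp add: pos_trace_scaleR c pos_trace_eavesdropper_state D(1) trace_norm_def)
  finally show ?thesis .
qed

theorem theorem1:
  fixes \<nu> loss :: real and \<rho> :: "fock \<Rightarrow> fock"
  assumes "\<nu> \<in> {0..1}" and "loss \<in> {0..1}"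
    and "density_op \<rho>" and "security_parameter \<rho> \<nu>"
  shows "protocol_secure ((1 - loss) * \<nu>) (lossy loss \<rho>)"
proof -
  obtain n \<psi> where \<psi>: "\<psi> \<in> fixed_number_space n" "norm \<psi> = 1"
    and close: "trace_distance (pure_state \<psi>) \<rho> \<le> ennreal \<nu>"
    using assms(4) by (auto simp: security_parameter_def)
  define A where "A \<phi> = pure_state \<psi> \<phi> - \<rho> \<phi>" for \<phi>
  have A: "hermitian A"
    unfolding A_def using assms(3)
    by (intro hermitian_diff positive_op_hermitian positive_op_pure_state) (simp add: density_op_def)
  define \<tau> where "\<tau> = eavesdropper_state (lossy loss (pure_state \<psi>)) 0"
  have \<tau>_eq: "\<tau> = eavesdropper_state (lossy loss (pure_state \<psi>)) x" if "x \<in> {0, 1}" for x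
    \<comment> \<open>Linearity splits the state into a part with \<open>n\<close> photons and the
      vacuum with 0 photons, each giving a state independent of Alice's input.\<close>
    using that eavesdropper_pure_state[OF photon_number_fixed_number_space[OF \<psi>(1)]]
      eavesdropper_pure_state[OF photon_number_vacuum]
    by (auto simp: \<tau>_def lossy_eq eavesdropper_state_convex)
  have "trace_distance \<tau> (eavesdropper_state (lossy loss \<rho>) x) \<le> ennreal ((1 - loss) * \<nu>)"
    if "x \<in> {0, 1}" for x
  proof -
    note lin = symmetric_op_linear[OF hermitian_symmetric_op[OF hermitian_encode]]
    \<comment> \<open>Rewriting \<tau> with the same \<open>x\<close> makes the vacuum terms
      identical, so they cancel.\<close>
    have "\<tau> \<phi> - eavesdropper_state (lossy loss \<rho>) x \<phi> = (1 - loss) *\<^sub>R eavesdropper_state A x \<phi>" for \<phi>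
      unfolding \<tau>_eq[OF that] lossy_eq eavesdropper_state_convex
      by (simp add: eavesdropper_state_eq A_def linear_diff[OF lin] flip: scaleR_diff_right)
    then have "trace_distance \<tau> (eavesdropper_state (lossy loss \<rho>) x) =
        trace_norm (\<lambda>\<phi>. (1 - loss) *\<^sub>R eavesdropper_state A x \<phi>) / 2"
      by (simp add: trace_distance_def)
    also have "\<dots> \<le> ennreal (1 - loss) * trace_norm A / 2"
      using assms(2) by (intro divide_right_mono_ennreal trace_norm_eavesdropper_le A) simp
    also have "\<dots> = ennreal (1 - loss) * trace_distance (pure_state \<psi>) \<rho>"
      by (simp add: trace_distance_def A_def[abs_def] ennreal_times_divide)
    also have "\<dots> \<le> ennreal (1 - loss) * ennreal \<nu>"
      by (intro mult_left_mono close) simp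
    also have "\<dots> = ennreal ((1 - loss) * \<nu>)"
      using assms(1,2) by (simp add: ennreal_mult)
    finally show ?thesis .
  qed
  moreover have "density_op \<tau>"
    unfolding \<tau>_def using assms(2) \<psi>(2)
    by (intro density_op_eavesdropper_state density_op_lossy density_op_pure_state)
  ultimately show ?thesis
    unfolding protocol_secure_def by blast
qed

end
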